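(* Let $\mathcal{A},\mathcal{B}\subseteq\mathcal{P}_\infty(\mathbb{N})$ be hereditary families with $\mathcal{A}\perp\mathcal{B}$. Assume that $\mathcal{A}$ is analytic and that $\mathcal{B}$ is $C$-measurable and an M-family. Then either (i) $\mathcal{A}$ is countably generated in $\mathcal{B}^\perp$, or (ii) there exists a perfect Lusin gap inside $(\mathcal{A},\mathcal{B})$.
   Context: For a countable set $X$, $\mathcal{P}_\infty(X)$ is the set of infinite subsets of $X$, viewed as a subspace of $2^X$ (so "analytic", "$C$-measurable" refer to this Polish topology). A set is $C$-measurable if it belongs to the smallest $\sigma$-algebra containing the open sets and closed under the Souslin operation. A family $\mathcal{A}\subseteq\mathcal{P}_\infty(X)$ is hereditary if $A\in\mathcal{A}$ and $A'\in\mathcal{P}_\infty(A)$ imply $A'\in\mathcal{A}$. A hereditary family $\mathcal{A}$ is an M-family if for every sequence $(A_n)_n$ in $\mathcal{A}$ there is $A\in\mathcal{A}$ such that for every $n$ the set $A\setminus\bigcup_{i\ge n}A_i$ is finite. For $A,B$ infinite, $A\perp B$ means $A\cap B$ is finite; $\mathcal{A}\perp\mathcal{B}$ means $A\perp B$ for all $A\in\mathcal{A},B\in\mathcal{B}$; $\mathcal{A}^\perp=\{B\in\mathcal{P}_\infty(X): B\perp A\ \forall A\in\mathcal{A}\}$. $A\subseteq^* B$ means $A\setminus B$ is finite. A family $\mathcal{A}$ is countably generated in a family $\mathcal{D}$ if there is a sequence $(D_n)_n$ in $\mathcal{D}$ such that every $A\in\mathcal{A}$ satisfies $A\subseteq^*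 D_n$ for some $n$. A perfect Lusin gap inside $(\mathcal{A},\mathcal{B})$ is a continuous one-to-one map $2^\mathbb{N}\ni x\mapsto(A_x,B_x)\in\mathcal{A}\times\mathcal{B}$ such that $A_x\cap B_x=\varnothing$ for all $x$, and $(A_x\cap B_y)\cup(A_y\cap B_x)\neq\varnothing$ for all $x\neq y$.
   Formalization: "Countably generated in D" is read with a countable, possibly empty, subfamily of D instead of a sequence in D; this matters only when A is empty, where the literal claim fails for B the family of all infinite sets (then B^⊥ is empty). *)

theory Defs
  imports Main "HOL-Library.Countable_Set"
begin

text \<open>Subsets of nat are identified with points of the Cantor space 2^N.
  The product topology on 2^N is described through the basic clopen sets
  determined by finite initial segments.\<close>

definition Pinf :: "nat set set" where
  "Pinf = {A. infinite A}"

definition open_Pinf :: "nat set set \<Rightarrow> bool" where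
  "open_Pinf U \<longleftrightarrow> U \<subseteq> Pinf \<and>
     (\<forall>A\<in>U. \<exists>n. \<forall>B\<in>Pinf. B \<inter> {..<n} = A \<inter> {..<n} \<longrightarrow> B \<in> U)"

definition baire_to_cantor_continuous :: "((nat \<Rightarrow> nat) \<Rightarrow> nat set) \<Rightarrow> bool" where
  "baire_to_cantor_continuous f \<longleftrightarrow>
     (\<forall>\<sigma> n. \<exists>m. \<forall>\<tau>. (\<forall>i<m. \<tau> i = \<sigma> i) \<longrightarrow> f \<tau> \<inter> {..<n} = f \<sigma> \<inter> {..<n})"

definition cantor_continuous :: "(nat set \<Rightarrow> nat set) \<Rightarrow> bool" where
  "cantor_continuous f \<longleftrightarrow>
     (\<forall>x n. \<exists>m. \<forall>y. y \<inter> {..<m} = x \<inter> {..<m} \<longrightarrow> f y \<inter> {..<n} = f x \<inter> {..<n})"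

definition analytic :: "nat set set \<Rightarrow> bool" where
  "analytic \<A> \<longleftrightarrow> \<A> \<subseteq> Pinf \<and>
     (\<A> = {} \<or> (\<exists>f. baire_to_cantor_continuous f \<and> range f = \<A>))"

inductive_set Cmeas :: "nat set set set" where
  open_Cmeas: "open_Pinf U \<Longrightarrow> U \<in> Cmeas"
| compl_Cmeas: "U \<in> Cmeas \<Longrightarrow> Pinf - U \<in> Cmeas"
| Union_Cmeas: "(\<And>n::nat. F n \<in> Cmeas) \<Longrightarrow> (\<Union>n. F n) \<in> Cmeas"
| Souslin_Cmeas: "(\<And>s::nat list. S s \<in> Cmeas) \<Longrightarrow>
     (\<Union>\<sigma>::nat \<Rightarrow> nat. \<Inter>n. S (map \<sigma> [0..<Suc n])) \<in> Cmeas"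

definition C_measurable :: "nat set set \<Rightarrow> bool" where
  "C_measurable \<A> \<longleftrightarrow> \<A> \<in> Cmeas"

definition hereditary :: "nat set set \<Rightarrow> bool" where
  "hereditary \<A> \<longleftrightarrow> (\<forall>A\<in>\<A>. \<forall>A'. A' \<subseteq> A \<and> infinite A' \<longrightarrow> A' \<in> \<A>)"

definition is_M_family :: "nat set set \<Rightarrow> bool" where
  "is_M_family \<A> \<longleftrightarrow> hereditary \<A> \<and>
     (\<forall>An::nat \<Rightarrow> nat set. (\<forall>n. An n \<in> \<A>) \<longrightarrow>
        (\<exists>A\<in>\<A>. \<forall>n. finite (A - (\<Union>i\<in>{n..}. An i))))"

definition orth :: "nat set set \<Rightarrow> nat set set \<Rightarrow> bool" where
  "orth \<A> \<B> \<longleftrightarrow> (\<forall>A\<in>\<A>. \<forall>B\<in>\<B>. finite (A \<inter> B))"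

definition perp :: "nat set set \<Rightarrow> nat set set" where
  "perp \<A> = {B \<in> Pinf. \<forall>A\<in>\<A>. finite (B \<inter> A)}"

definition countably_generated_in :: "nat set set \<Rightarrow> nat set set \<Rightarrow> bool" where
  "countably_generated_in \<A> \<D> \<longleftrightarrow>
     (\<exists>\<D>'. countable \<D>' \<and> \<D>' \<subseteq> \<D> \<and> (\<forall>A\<in>\<A>. \<exists>D\<in>\<D>'. finite (A - D)))"

definition perfect_Lusin_gap :: "nat set set \<Rightarrow> nat set set \<Rightarrow> bool" where
  "perfect_Lusin_gap \<A> \<B> \<longleftrightarrow>
     (\<exists>fA fB. cantor_continuous fA \<and> cantor_continuous fB \<and>
        inj (\<lambda>x. (fA x, fB x)) \<and>
        (\<forall>x. fA x \<in> \<A> \<and> fB x \<in> \<B> \<and> fA x \<inter> fB x = {}) \<and>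
        (\<forall>x y. x \<noteq> y \<longrightarrow> (fA x \<inter> fB y) \<union> (fA y \<inter> fB x) \<noteq> {}))"

end

theory Submission
  imports Defs
begin

text \<open>
  Suppose that \<open>\<A>\<close> is not countably generated in \<open>\<B>\<^sup>\<bottom>\<close>. Removing the countably generated
  part from a continuous image of the Baire space leaves a tree \<open>v\<close> in which the
  successors of every node form an element of \<open>\<B>\<close> and every branch \<open>x\<close> is an element \<open>A(x)\<close> of \<open>\<A>\<close>.
  An infinite set \<open>N\<close> selects teeth \<open>v (x|a) b\<close> along \<open>x\<close>, one for every second pair \<open>a < b\<close> of
  consecutive elements of \<open>N\<close>, and by the M-property every infinite set contains some \<open>N\<close>
  whose teeth lie in \<open>\<B>\<close> and avoid \<open>A(x)\<close>.

  The main point is to choose \<open>N\<close> as a Baire measurable function of \<open>x\<close>. For this Ellentuck's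
  theorem is proved for Cohen-names of infinite sets: a name is a monotone assignment
  of sets of numbers to finite sequences, and the relations between \<open>x\<close> and \<open>N\<close> that can be
  decided by passing to a longer initial segment of \<open>x\<close> and to a smaller name form a \<open>\<sigma>\<close>-algebra
  that contains the open relations and is closed under the Souslin operation. Hence there is a name
  whose value at a comeagre set of \<open>x\<close> in some cylinder is as required.

  If an initial segment of \<open>x\<close> decides that \<open>v (x|a) b\<close> is a tooth, then every branch \<open>y\<close> that
  leaves \<open>x\<close> at level \<open>a\<close> through \<open>b\<close> has this tooth in \<open>A(y)\<close>. Splitting a perfect tree of generic
  branches in this way gives the gap.
\<close>

section \<open>Category forcing on the Baire space\<close>

definition ini :: "(nat \<Rightarrow> nat) \<Rightarrow> nat \<Rightarrow> nat list" where
  "ini x k = map x [0..<k]"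

definition cyl :: "nat list \<Rightarrow> (nat \<Rightarrow> nat) set" where
  "cyl s = {x. ini x (length s) = s}"

text \<open>The category quantifier: \<open>\<phi>\<close> holds on a comeagre subset of
  \<open>cyl s\<close>. Each \<open>D i\<close> is dense in the tree of finite sequences, so the
  points meeting all of them form a dense G-delta set.\<close>

definition forces :: "nat list \<Rightarrow> ((nat \<Rightarrow> nat) \<Rightarrow> bool) \<Rightarrow> bool" where
  "forces s \<phi> \<longleftrightarrow> (\<exists>D::nat \<Rightarrow> nat list set. (\<forall>i t. \<exists>u. t @ u \<in> D i) \<and>
     (\<forall>x\<in>cyl s. (\<forall>i. \<exists>k. ini x k \<in> D i) \<longrightarrow> \<phi> x))"

lemma length_ini [simp]: "length (ini x k) = k"
  by (simp add: ini_def)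

lemma ini_in_cyl [simp]: "x \<in> cyl (ini x k)"
  by (simp add: cyl_def)

lemma cyl_Nil [simp]: "x \<in> cyl []"
  by (simp add: cyl_def ini_def)

lemma ini_add: "\<exists>u. ini x (k + l) = ini x k @ u"
  using upt_add_eq_append[of 0 k l] by (simp add: ini_def)

lemma ini_le: "k \<le> l \<Longrightarrow> \<exists>u. ini x l = ini x k @ u"
  using ini_add[of x k "l - k"] by simp

lemma ini_Suc: "ini x (Suc k) = ini x k @ [x k]"
  by (simp add: ini_def)

lemma take_ini: "k \<le> l \<Longrightarrow> take k (ini x l) = ini x k"
  by (simp add: ini_def take_map)

lemma cyl_append: "x \<in> cyl (s @ u) \<Longrightarrow> x \<in> cyl s"
proof -
  assume "x \<in> cyl (s @ u)"
  then have "ini x (length s + length u) = s @ u" by (simp add: cyl_def)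
  then have "take (length s) (ini x (length s + length u)) = s" by simp
  then show ?thesis by (simp add: cyl_def take_ini)
qed

lemma cyl_ini_ge: "x \<in> cyl s \<Longrightarrow> length s \<le> k \<Longrightarrow> \<exists>u. ini x k = s @ u"
  using ini_le[of "length s" k x] by (simp add: cyl_def)

lemma cyl_ini_le: "x \<in> cyl (ini y k) \<Longrightarrow> l \<le> k \<Longrightarrow> ini x l = ini y l"
  using take_ini[of l k x] take_ini[of l k y] by (simp add: cyl_def)

lemma cyl_iniD: "x \<in> cyl s \<Longrightarrow> length s = k \<Longrightarrow> ini x k = s"
  by (auto simp: cyl_def)

lemma cyl_nth: "x \<in> cyl s \<Longrightarrow> i < length s \<Longrightarrow> x i = s ! i"
proof -
  assume "x \<in> cyl s" "i < length s"
  then have "ini x (length s) ! i = s ! i" by (simp add: cyl_def)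
  then show ?thesis using \<open>i < length s\<close> by (simp add: ini_def)
qed

lemma chain_limit:
  assumes "\<And>n. \<exists>u. u \<noteq> [] \<and> t (Suc n) = t n @ u"
  shows "\<exists>x. \<forall>n. x \<in> cyl (t n)"
proof -
  have ext: "\<exists>u. t (n + d) = t n @ u" for n d
  proof (induction d)
    case (Suc d)
    then show ?case using assms[of "n + d"] by auto
  qed simp
  have len: "n \<le> length (t n)" for n
  proof (induction n)
    case (Suc n)
    obtain u where "u \<noteq> []" "t (Suc n) = t n @ u" using assms by blast
    then show ?case using Suc by (cases u) auto
  qed simp
  \<comment> \<open>\<open>t (Suc i)\<close> has length at least \<open>Suc i\<close>, so its entry
    at \<open>i\<close> exists, and all later members of the chain agree with it there.\<close>
  define x where "x i = t (Suc i) ! i" for i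
  have nth: "t n ! i = x i" if "i < length (t n)" for n i
  proof (cases "n \<le> Suc i")
    case True
    then obtain u where "t (Suc i) = t n @ u" using ext[of n "Suc i - n"] by auto
    then show ?thesis using that by (simp add: x_def nth_append)
  next
    case False
    then obtain u where "t n = t (Suc i) @ u" using ext[of "Suc i" "n - Suc i"] by auto
    then show ?thesis using len[of "Suc i"] by (simp add: x_def nth_append)
  qed
  have "x \<in> cyl (t n)" for n
    unfolding cyl_def ini_def using nth by (auto intro!: nth_equalityI)
  then show ?thesis by blast
qed

section \<open>Calculus of the category quantifier\<close>

lemma forces_mono:
  assumes "forces s \<phi>" and "\<And>x. x \<in> cyl s \<Longrightarrow> \<phi> x \<Longrightarrow> \<psi> x"
  shows "forces s \<psi>"
  using assms unfolding forces_def by blast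

lemma forces_append: "forces s \<phi> \<Longrightarrow> forces (s @ u) \<phi>"
  unfolding forces_def using cyl_append by blast

lemma forces_trivial: "(\<And>x. x \<in> cyl s \<Longrightarrow> \<phi> x) \<Longrightarrow> forces s \<phi>"
  unfolding forces_def by (rule exI[of _ "\<lambda>_. UNIV"]) auto

text \<open>A countable intersection of comeagre sets is comeagre: the countably many sequences of
  dense sets are merged into one by the pairing function.\<close>

lemma forces_all:
  fixes \<phi> :: "nat \<Rightarrow> (nat \<Rightarrow> nat) \<Rightarrow> bool"
  assumes "\<And>i. forces s (\<phi> i)"
  shows "forces s (\<lambda>x. \<forall>i. \<phi> i x)"
proof -
  have "\<forall>i. \<exists>D::nat \<Rightarrow> nat list set. (\<forall>j t. \<exists>u. t @ u \<in> D j) \<and>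
     (\<forall>x\<in>cyl s. (\<forall>j. \<exists>k. ini x k \<in> D j) \<longrightarrow> \<phi> i x)"
    using assms unfolding forces_def by blast
  from choice[OF this] obtain D :: "nat \<Rightarrow> nat \<Rightarrow> nat list set" where
    D: "\<And>i j t. \<exists>u. t @ u \<in> D i j"
      "\<And>i x. x \<in> cyl s \<Longrightarrow> (\<forall>j. \<exists>k. ini x k \<in> D i j) \<Longrightarrow> \<phi> i x" by blast
  let ?D = "\<lambda>n. case prod_decode n of (i, j) \<Rightarrow> D i j"
  have "\<exists>u. t @ u \<in> ?D n" for t n using D(1) by (simp split: prod.split)
  moreover have "\<phi> i x" if x: "x \<in> cyl s" and m: "\<forall>n. \<exists>k. ini x k \<in> ?D n" for x i
  proof (rule D(2)[OF x], rule allI)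
    fix j show "\<exists>k. ini x k \<in> D i j" using m[rule_format, of "prod_encode (i, j)"] by simp
  qed
  ultimately show ?thesis unfolding forces_def by (intro exI[of _ ?D]) blast
qed

lemma forces_ball:
  assumes "countable I" and "\<And>i. i \<in> I \<Longrightarrow> forces s (\<phi> i)"
  shows "forces s (\<lambda>x. \<forall>i\<in>I. \<phi> i x)"
proof (cases "I = {}")
  case True
  then show ?thesis by (simp add: forces_trivial)
next
  case False
  have "forces s (\<lambda>x. \<forall>n. \<phi> (from_nat_into I n) x)"
    by (rule forces_all) (simp add: assms(2) False from_nat_into)
  then show ?thesis
    by (rule forces_mono) (use from_nat_into_surj[OF assms(1)] in blast)
qed

lemma forces_countable:
  fixes \<phi> :: "'i::countable \<Rightarrow> (nat \<Rightarrow> nat) \<Rightarrow> bool"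
  assumes "\<And>i. forces s (\<phi> i)"
  shows "forces s (\<lambda>x. \<forall>i. \<phi> i x)"
  using forces_ball[of UNIV s \<phi>] assms by simp

lemma forces_conj:
  assumes "forces s \<phi>" and "forces s \<psi>"
  shows "forces s (\<lambda>x. \<phi> x \<and> \<psi> x)"
proof -
  have "forces s (\<lambda>x. \<forall>b. (if b then \<phi> x else \<psi> x))"
    proof (rule forces_countable)
    fix b :: bool
    show "forces s (\<lambda>x. if b then \<phi> x else \<psi> x)" using assms by (cases b) simp_all
  qed
  then show ?thesis by (rule forces_mono) (auto simp: all_bool_eq)
qed

text \<open>Being comeagre is a local property, so densely many cylinders below \<open>s\<close>
  suffice. There are only countably many cylinders, hence the dense sets for all of them can be met
  at once.\<close>

lemma forces_local:
  assumes "\<And>u. \<exists>w. forces (s @ u @ w) \<phi>"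
  shows "forces s \<phi>"
proof -
  have "\<forall>r. \<exists>D::nat \<Rightarrow> nat list set. (\<forall>j t. \<exists>u. t @ u \<in> D j) \<and>
     (forces r \<phi> \<longrightarrow> (\<forall>x\<in>cyl r. (\<forall>j. \<exists>k. ini x k \<in> D j) \<longrightarrow> \<phi> x))"
  proof
    fix r
    show "\<exists>D::nat \<Rightarrow> nat list set. (\<forall>j t. \<exists>u. t @ u \<in> D j) \<and>
     (forces r \<phi> \<longrightarrow> (\<forall>x\<in>cyl r. (\<forall>j. \<exists>k. ini x k \<in> D j) \<longrightarrow> \<phi> x))"
    proof (cases "forces r \<phi>")
      case True
      then show ?thesis unfolding forces_def by blast
    next
      case False
      then show ?thesis by (intro exI[of _ "\<lambda>_. UNIV"]) simp
    qed
  qed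
  from choice[OF this] obtain D :: "nat list \<Rightarrow> nat \<Rightarrow> nat list set" where
    D: "\<And>r j t. \<exists>u. t @ u \<in> D r j"
      "\<And>r x. forces r \<phi> \<Longrightarrow> x \<in> cyl r \<Longrightarrow> (\<forall>j. \<exists>k. ini x k \<in> D r j) \<Longrightarrow> \<phi> x" by blast
  \<comment> \<open>Meeting \<open>E\<close> means reaching a node that either lies inside a
    cylinder where \<open>\<phi>\<close> is forced or has no such cylinder below it. This set is
    dense everywhere, as the definition of \<open>forces\<close> demands.\<close>
  define E where "E = {t. (\<exists>r w. t = r @ w \<and> forces r \<phi>) \<or> (\<forall>w. \<not> forces (t @ w) \<phi>)}"
  let ?D = "\<lambda>n. case n of 0 \<Rightarrow> E | Suc m \<Rightarrow> (case from_nat m of (r, j) \<Rightarrow> D r j)"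
  have "\<exists>u. t @ u \<in> ?D n" for t n
  proof (cases n)
    case 0
    have "\<exists>u. t @ u \<in> E"
    proof (cases "\<exists>w. forces (t @ w) \<phi>")
      case True
      then obtain w where "forces (t @ w) \<phi>" by blast
      then have "t @ w \<in> E" unfolding E_def by (intro CollectI disjI1 exI[of _ "t @ w"] exI[of _ "[]"]) simp
      then show ?thesis by blast
    next
      case False
      then have "t @ [] \<in> E" unfolding E_def by auto
      then show ?thesis by blast
    qed
    then show ?thesis using 0 by simp
  next
    case (Suc m)
    then show ?thesis using D(1) by (simp split: prod.split)
  qed
  moreover have "\<phi> x" if x: "x \<in> cyl s" and m: "\<forall>n. \<exists>k. ini x k \<in> ?D n" for x
  proof -
    have mD: "\<exists>k. ini x k \<in> D r j" for r j
      using m[rule_format, of "Suc (to_nat (r, j))"] by simp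
    obtain k where k: "ini x k \<in> E" using m[rule_format, of 0] by auto
    \<comment> \<open>For points of \<open>cyl s\<close> the second alternative contradicts the
      assumption, once the node of \<open>E\<close> and \<open>s\<close> are compared through a
      common longer initial segment of \<open>x\<close>.\<close>
    have "\<not> (\<forall>w. \<not> forces (ini x k @ w) \<phi>)"
    proof
      assume n: "\<forall>w. \<not> forces (ini x k @ w) \<phi>"
      let ?l = "max k (length s)"
      obtain u where u: "ini x ?l = s @ u" using cyl_ini_ge[OF x, of ?l] by auto
      obtain v where v: "ini x ?l = ini x k @ v" using ini_le[of k ?l x] by auto
      obtain w where "forces (s @ u @ w) \<phi>" using assms by blast
      moreover have "s @ u @ w = ini x k @ (v @ w)" using u v by (simp flip: append_assoc)
      ultimately have "forces (ini x k @ (v @ w)) \<phi>" by simp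
      then show False using n by blast
    qed
    then obtain r w where r: "ini x k = r @ w" "forces r \<phi>" using k unfolding E_def by blast
    have "x \<in> cyl r" using cyl_append[of x r w] ini_in_cyl[of x k] r(1) by simp
    then show ?thesis using D(2)[OF r(2)] mD by blast
  qed
  ultimately show ?thesis unfolding forces_def by (intro exI[of _ ?D]) blast
qed

text \<open>\<open>U\<close> is dense only below \<open>s\<close>, whereas \<open>forces\<close>
  asks for sets that are dense everywhere; \<open>forces_local\<close> bridges this, since a node in
  \<open>U\<close> makes the claim true on its whole cylinder.\<close>

lemma forces_meets:
  assumes "\<And>u. \<exists>w. s @ u @ w \<in> U"
  shows "forces s (\<lambda>x. \<exists>k. ini x k \<in> U)"
proof (rule forces_local)
  fix u
  obtain w where w: "s @ u @ w \<in> U" using assms by blast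
  have "forces (s @ u @ w) (\<lambda>x. \<exists>k. ini x k \<in> U)"
  proof (rule forces_trivial)
    fix x assume "x \<in> cyl (s @ u @ w)"
    then have "ini x (length (s @ u @ w)) = s @ u @ w" by (simp add: cyl_def)
    then show "\<exists>k. ini x k \<in> U" using w by metis
  qed
  then show "\<exists>w. forces (s @ u @ w) (\<lambda>x. \<exists>k. ini x k \<in> U)" by blast
qed

text \<open>A generic point satisfies whatever its own initial segments force. For one pair of a
  node and an index this is the meaning of \<open>forces\<close>, and there are only countably many
  pairs. In this way forcing statements found during a construction become facts about the point
  under consideration.\<close>

lemma forces_self:
  assumes "countable I"
  shows "forces s (\<lambda>x. \<forall>i\<in>I. \<forall>k. forces (ini x k) (\<phi> i) \<longrightarrow> \<phi> i x)"
proof -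
  have "forces s (\<lambda>x. \<forall>p\<in>UNIV \<times> I. x \<in> cyl (fst p) \<longrightarrow> forces (fst p) (\<phi> (snd p)) \<longrightarrow> \<phi> (snd p) x)"
  proof (rule forces_ball)
    show "countable ((UNIV :: nat list set) \<times> I)" using assms by simp
  next
    fix p :: "nat list \<times> 'a"
    obtain r i where p: "p = (r, i)" by (cases p)
    show "forces s (\<lambda>x. x \<in> cyl (fst p) \<longrightarrow> forces (fst p) (\<phi> (snd p)) \<longrightarrow> \<phi> (snd p) x)"
    proof (cases "forces r (\<phi> i)")
      case True
      then obtain D :: "nat \<Rightarrow> nat list set" where "\<forall>i t. \<exists>u. t @ u \<in> D i"
        "\<forall>x\<in>cyl r. (\<forall>i. \<exists>k. ini x k \<in> D i) \<longrightarrow> \<phi> i x" unfolding forces_def by blast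
      then show ?thesis unfolding p forces_def[of s] by (intro exI[of _ D]) auto
    next
      case False
      then show ?thesis unfolding p by (simp add: forces_trivial)
    qed
  qed
  then show ?thesis
  proof (rule forces_mono, intro ballI allI impI)
    fix x i k
    assume *: "\<forall>p\<in>UNIV \<times> I. x \<in> cyl (fst p) \<longrightarrow> forces (fst p) (\<phi> (snd p)) \<longrightarrow> \<phi> (snd p) x"
      and "i \<in> I" "forces (ini x k) (\<phi> i)"
    then show "\<phi> i x" using bspec[OF *, of "(ini x k, i)"] by simp
  qed
qed

lemma forces_self_finite_sets:
  fixes \<phi> :: "'i::countable \<Rightarrow> nat set \<Rightarrow> (nat \<Rightarrow> nat) \<Rightarrow> bool"
  shows "forces s (\<lambda>x. \<forall>i e k. finite e \<longrightarrow> forces (ini x k) (\<phi> i e) \<longrightarrow> \<phi> i e x)"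
proof -
  have "countable ((UNIV::'i set) \<times> {e::nat set. finite e})"
    by (simp add: countable_Collect_finite)
  from forces_self[OF this, of s "\<lambda>p. \<phi> (fst p) (snd p)"] show ?thesis
    by (rule forces_mono) auto
qed

text \<open>The Baire category theorem: a chain of nodes enters \<open>D 0\<close>,
  \<open>D 1\<close>, ... in turn, and its limit is generic.\<close>

lemma forces_witness:
  assumes "forces s \<phi>"
  shows "\<exists>x\<in>cyl s. \<phi> x"
proof -
  obtain D :: "nat \<Rightarrow> nat list set" where D: "\<And>i t. \<exists>u. t @ u \<in> D i"
    "\<And>x. x\<in>cyl s \<Longrightarrow> (\<forall>i. \<exists>k. ini x k \<in> D i) \<Longrightarrow> \<phi> x"
    using assms unfolding forces_def by blast
  define f where "f i t = (SOME u. t @ u \<in> D i)" for i t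
  have f: "t @ f i t \<in> D i" for i t unfolding f_def using someI_ex[OF D(1)] .
  \<comment> \<open>The entry \<open>0\<close> makes each step a proper extension even when the
    chosen \<open>f n\<close> is empty, as \<open>chain_limit\<close> requires.\<close>
  define t where "t = rec_nat s (\<lambda>n t. t @ [0] @ f n (t @ [0]))"
  have t: "t 0 = s" "t (Suc n) = t n @ [0] @ f n (t n @ [0])" for n by (simp_all add: t_def)
  obtain x where x: "\<And>n. x \<in> cyl (t n)" using chain_limit[of t] t(2) by auto
  have "\<exists>k. ini x k \<in> D i" for i
  proof -
    have "t (Suc i) \<in> D i" using f[of "t i @ [0]" i] t(2) by simp
    moreover have "ini x (length (t (Suc i))) = t (Suc i)" using x[of "Suc i"] by (simp add: cyl_def)
    ultimately show ?thesis by metis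
  qed
  moreover have "x \<in> cyl s" using x[of 0] t(1) by simp
  ultimately show ?thesis using D(2) by blast
qed

section \<open>Names for infinite sets\<close>

text \<open>A Cohen name for an infinite subset of the naturals: \<open>M t\<close> collects the
  numbers that the condition \<open>t\<close> already puts in. The second clause keeps arbitrarily
  large elements available below \<open>s\<close>, which makes the value \<open>ev M x\<close>
  infinite for generic \<open>x\<close> in \<open>cyl s\<close>.\<close>

definition name :: "nat list \<Rightarrow> (nat list \<Rightarrow> nat set) \<Rightarrow> bool" where
  "name s M \<longleftrightarrow> (\<forall>t u. M t \<subseteq> M (t @ u)) \<and> (\<forall>u m. \<exists>w. \<exists>n\<in>M (s @ u @ w). m \<le> n)"

definition ev :: "(nat list \<Rightarrow> nat set) \<Rightarrow> (nat \<Rightarrow> nat) \<Rightarrow> nat set" where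
  "ev M x = (\<Union>k. M (ini x k))"

definition below :: "nat list \<Rightarrow> (nat list \<Rightarrow> nat set) \<Rightarrow> (nat list \<Rightarrow> nat set) \<Rightarrow> bool" where
  "below s M A \<longleftrightarrow> (\<forall>u. M (s @ u) \<subseteq> A (s @ u))"

definition trim :: "nat \<Rightarrow> (nat list \<Rightarrow> nat set) \<Rightarrow> nat list \<Rightarrow> nat set" where
  "trim m M t = M t \<inter> {m..}"

lemma name_mono: "name s M \<Longrightarrow> M t \<subseteq> M (t @ u)"
  unfolding name_def by blast

lemma name_unbounded: "name s M \<Longrightarrow> \<exists>w. \<exists>n\<in>M (s @ u @ w). m \<le> n"
  unfolding name_def by blast

lemma name_append: "name s M \<Longrightarrow> name (s @ u) M"
  unfolding name_def by (metis append.assoc)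

lemma name_mono_ini: "name s M \<Longrightarrow> k \<le> l \<Longrightarrow> M (ini x k) \<subseteq> M (ini x l)"
  using name_mono ini_le by metis

lemma name_trim: "name s M \<Longrightarrow> name s (trim m M)"
  unfolding name_def trim_def
proof (intro conjI allI)
  fix u m' assume *: "(\<forall>t u. M t \<subseteq> M (t @ u)) \<and> (\<forall>u m. \<exists>w. \<exists>n\<in>M (s @ u @ w). m \<le> n)"
  then obtain w n where "n \<in> M (s @ u @ w)" "max m m' \<le> n" by blast
  then show "\<exists>w. \<exists>n\<in>M (s @ u @ w) \<inter> {m..}. m' \<le> n" by auto
qed blast

lemma ev_trim: "ev (trim m M) x = ev M x \<inter> {m..}"
  by (auto simp: ev_def trim_def)

lemma below_refl [simp]: "below s M M"
  by (simp add: below_def)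

lemma below_trim: "below s (trim m M) M"
  by (simp add: below_def trim_def)

lemma below_trans: "below s M A \<Longrightarrow> below s A A' \<Longrightarrow> below s M A'"
  unfolding below_def by blast

lemma below_append: "below s M A \<Longrightarrow> below (s @ u) M A"
  unfolding below_def by simp

lemma below_trim_mono: "below s M A \<Longrightarrow> below s (trim m M) (trim m A)"
  unfolding below_def trim_def by blast

text \<open>A number that enters at a node shorter than \<open>s\<close> is still present, by
  monotonicity, at a node extending \<open>s\<close>, where the inclusion is available.\<close>

lemma ev_below:
  assumes "name r M" "below s M A" "x \<in> cyl s"
  shows "ev M x \<subseteq> ev A x"
proof
  fix n assume "n \<in> ev M x"
  then obtain k where k: "n \<in> M (ini x k)" by (auto simp: ev_def)
  let ?l = "max k (length s)"
  obtain u where u: "ini x ?l = s @ u" using cyl_ini_ge[OF assms(3), of ?l] by auto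
  have "n \<in> M (ini x ?l)" using k name_mono_ini[OF assms(1), of k ?l x] by auto
  then have "n \<in> A (ini x ?l)" using assms(2) u by (auto simp: below_def)
  then show "n \<in> ev A x" by (auto simp: ev_def)
qed

lemma finite_subset_ev:
  assumes "name s M" "finite F" "F \<subseteq> ev M x"
  shows "\<exists>k. \<forall>l\<ge>k. F \<subseteq> M (ini x l)"
  using assms(2,3)
proof (induction F rule: finite_induct)
  case (insert n F)
  then obtain k where k: "\<forall>l\<ge>k. F \<subseteq> M (ini x l)" by blast
  obtain k' where k': "n \<in> M (ini x k')" using insert by (auto simp: ev_def)
  have "\<forall>l\<ge>max k k'. insert n F \<subseteq> M (ini x l)"
  proof (intro allI impI)
    fix l assume "max k k' \<le> l"
    then show "insert n F \<subseteq> M (ini x l)" using k k' name_mono_ini[OF assms(1), of k' l x] by auto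
  qed
  then show ?case by blast
qed simp

lemma forces_infinite_ev:
  assumes "name s M"
  shows "forces s (\<lambda>x. infinite (ev M x))"
proof -
  have "forces s (\<lambda>x. \<forall>m. \<exists>k. ini x k \<in> {t. \<exists>n\<in>M t. m \<le> n})"
    by (intro forces_all forces_meets) (use name_unbounded[OF assms] in blast)
  then show ?thesis
  proof (rule forces_mono)
    fix x assume "\<forall>m. \<exists>k. ini x k \<in> {t. \<exists>n\<in>M t. m \<le> n}"
    then have "\<forall>m. \<exists>n\<ge>m. n \<in> ev M x" unfolding ev_def by blast
    then show "infinite (ev M x)" by (simp add: infinite_nat_iff_unbounded_le)
  qed
qed

section \<open>Hereditary properties, gluing and fusion of names\<close>

definition hered :: "(nat list \<Rightarrow> (nat list \<Rightarrow> nat set) \<Rightarrow> bool) \<Rightarrow> bool" where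
  "hered Q \<longleftrightarrow> (\<forall>r M u. Q r M \<longrightarrow> Q (r @ u) M) \<and>
     (\<forall>r M M'. Q r M \<longrightarrow> name r M' \<longrightarrow> below r M' M \<longrightarrow> Q r M')"

lemma heredD1: "hered Q \<Longrightarrow> Q r M \<Longrightarrow> Q (r @ u) M"
  unfolding hered_def by blast

lemma heredD2: "hered Q \<Longrightarrow> Q r M \<Longrightarrow> name r M' \<Longrightarrow> below r M' M \<Longrightarrow> Q r M'"
  unfolding hered_def by blast

lemma hered_disj: "hered Q \<Longrightarrow> hered Q' \<Longrightarrow> hered (\<lambda>r M. Q r M \<or> Q' r M)"
  unfolding hered_def by blast

text \<open>The mixing principle of forcing. Local solutions are chosen at an antichain of nodes
  that is predense below \<open>s\<close> and glued into one name; heredity of \<open>Q\<close>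
  carries the property from the chosen name to the glued one on longer nodes.\<close>

lemma name_mixing:
  assumes A: "name s A" and Q: "hered Q"
    and dense: "\<And>u A'. name (s @ u) A' \<Longrightarrow> below (s @ u) A' A \<Longrightarrow>
      \<exists>w M. name (s @ u @ w) M \<and> below (s @ u @ w) M A' \<and> Q (s @ u @ w) M"
  shows "\<exists>M. name s M \<and> below s M A \<and> (\<forall>u. \<exists>w. Q (s @ u @ w) M)"
proof -
  define ok where "ok r M \<longleftrightarrow> name r M \<and> below r M A \<and> Q r M" for r M
  \<comment> \<open>\<open>G\<close> consists of the nodes at which some local solution exists, and
    \<open>F\<close> fixes one for each of them.\<close>
  define G where "G = {r. (\<exists>u. r = s @ u) \<and> (\<exists>M. ok r M)}"
  define F where "F r = (SOME M. ok r M)" for r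
  have F: "ok r (F r)" if "r \<in> G" for r
    using that someI_ex[of "ok r"] unfolding G_def F_def by blast
  have G_dense: "\<exists>w. s @ u @ w \<in> G" for u
  proof -
    obtain w M where "name (s @ u @ w) M" "below (s @ u @ w) M A" "Q (s @ u @ w) M"
      using dense[of u A] name_append[OF A] below_refl by blast
    then have "s @ u @ w \<in> G" unfolding G_def ok_def by blast
    then show ?thesis by blast
  qed
  \<comment> \<open>Using the first node of \<open>G\<close> along \<open>t\<close> makes the
    selected nodes an antichain, so all extensions of such a node consult the same
    \<open>F r\<close>. This gives monotonicity; before \<open>G\<close> is reached the name is
    empty.\<close>
  define h where "h t = (LEAST k. take k t \<in> G)" for t
  define M where "M t = (if \<exists>k. take k t \<in> G then F (take (h t) t) t else {})" for t
  have hle: "h t \<le> length t" and hG: "take (h t) t \<in> G" if ex: "\<exists>k. take k t \<in> G" for t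
  proof -
    show "take (h t) t \<in> G" unfolding h_def using ex by (rule LeastI_ex)
    obtain k where k: "take k t \<in> G" using ex by blast
    show "h t \<le> length t"
    proof (cases "k \<le> length t")
      case True
      then show ?thesis using Least_le[of "\<lambda>k. take k t \<in> G", OF k] unfolding h_def by simp
    next
      case False
      then have "take (length t) t \<in> G" using k by simp
      then show ?thesis unfolding h_def by (rule Least_le)
    qed
  qed
  have stable: "take (h (t @ u)) (t @ u) = take (h t) t \<and> (\<exists>k. take k (t @ u) \<in> G)"
    if ex: "\<exists>k. take k t \<in> G" for t u
  proof -
    have in': "take (h t) (t @ u) \<in> G" using hG[OF ex] hle[OF ex] by simp
    then have ex': "\<exists>k. take k (t @ u) \<in> G" by blast
    have "h (t @ u) \<le> h t" using Least_le[of "\<lambda>k. take k (t @ u) \<in> G", OF in'] by (simp add: h_def)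
    moreover have "h t \<le> h (t @ u)"
    proof -
      have "take (h (t @ u)) t \<in> G" using hG[OF ex'] hle[OF ex] calculation by simp
      then show ?thesis unfolding h_def[of t] by (rule Least_le)
    qed
    ultimately show ?thesis using ex' hle[OF ex] by simp
  qed
  have M_eq: "M (t @ u) = F (take (h t) t) (t @ u)" if "\<exists>k. take k t \<in> G" for t u
    using stable[OF that, of u] by (simp add: M_def)
  have mono: "M t \<subseteq> M (t @ u)" for t u
  proof (cases "\<exists>k. take k t \<in> G")
    case True
    have "name (take (h t) t) (F (take (h t) t))" using F[OF hG[OF True]] by (simp add: ok_def)
    then show ?thesis using M_eq[OF True, of u] M_eq[OF True, of "[]"] name_mono by simp
  qed (simp add: M_def)
  have loc: "\<exists>w. \<exists>k. take k (s @ u @ w) \<in> G" for u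
  proof -
    obtain w where "s @ u @ w \<in> G" using G_dense by blast
    then have "take (length (s @ u @ w)) (s @ u @ w) \<in> G" by simp
    then show ?thesis by blast
  qed
  have unb: "\<exists>w. \<exists>n\<in>M (s @ u @ w). m \<le> n" for u m
  proof -
    obtain w where ex: "\<exists>k. take k (s @ u @ w) \<in> G" using loc by blast
    \<comment> \<open>\<open>r\<close> is the first node of \<open>G\<close> along the sequence. On
      its extensions that prolong the sequence \<open>M\<close> agrees with \<open>F r\<close>, so
      unboundedness is inherited from that name.\<close>
    define r v where "r = take (h (s @ u @ w)) (s @ u @ w)" and "v = drop (h (s @ u @ w)) (s @ u @ w)"
    then have r: "take (h (s @ u @ w)) (s @ u @ w) = r" "s @ u @ w = r @ v" "r \<in> G"
      using hG[OF ex] by (simp_all only: append_take_drop_id)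
    have "name r (F r)" using F[OF r(3)] by (simp add: ok_def)
    then obtain z n where z: "n \<in> F r (r @ v @ z)" "m \<le> n" using name_unbounded by blast
    have "(s @ u @ w) @ z = r @ v @ z" by (simp only: r(2) append_assoc)
    then have "n \<in> M ((s @ u @ w) @ z)" unfolding M_eq[OF ex] r(1) using z(1) by simp
    then have "n \<in> M (s @ u @ (w @ z))" by simp
    then show ?thesis using z(2) by blast
  qed
  have name: "name s M" unfolding name_def using mono unb by blast
  have below: "below s M A" unfolding below_def
  proof
    fix u show "M (s @ u) \<subseteq> A (s @ u)"
    proof (cases "\<exists>k. take k (s @ u) \<in> G")
      case True
      let ?r = "take (h (s @ u)) (s @ u)"
      have "below ?r (F ?r) A" using F[OF hG[OF True]] by (simp add: ok_def)
      then have "F ?r (?r @ drop (h (s @ u)) (s @ u)) \<subseteq> A (?r @ drop (h (s @ u)) (s @ u))"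
        unfolding below_def by blast
      then have "F ?r (s @ u) \<subseteq> A (s @ u)" by (simp only: append_take_drop_id)
      then show ?thesis using M_eq[OF True, of "[]"] by simp
    qed (simp add: M_def)
  qed
  have "\<exists>w. Q (s @ u @ w) M" for u
  proof -
    obtain w where ex: "\<exists>k. take k (s @ u @ w) \<in> G" using loc by blast
    define r v where "r = take (h (s @ u @ w)) (s @ u @ w)" and "v = drop (h (s @ u @ w)) (s @ u @ w)"
    then have r: "take (h (s @ u @ w)) (s @ u @ w) = r" "s @ u @ w = r @ v" "r \<in> G"
      using hG[OF ex] by (simp_all only: append_take_drop_id)
    have "Q r (F r)" using F[OF r(3)] by (simp add: ok_def)
    then have "Q (s @ u @ w) (F r)" unfolding r(2) by (rule heredD1[OF Q])
    moreover have "below (s @ u @ w) M (F r)"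
      unfolding below_def M_eq[OF ex] r(1) by blast
    moreover have "name (s @ u @ w) M" using name by (rule name_append)
    ultimately show ?thesis using heredD2[OF Q, of "s @ u @ w" "F r" M] by blast
  qed
  then show ?thesis using name below by blast
qed

text \<open>The properties are secured one after another; by heredity those already obtained survive
  the next refinement.\<close>

lemma finite_name_mixing:
  assumes "finite T" and A: "name s A" and Q: "\<And>\<tau>. hered (Q \<tau>)"
    and dense: "\<And>\<tau> u A'. \<tau> \<in> T \<Longrightarrow> name (s @ u) A' \<Longrightarrow> below (s @ u) A' A \<Longrightarrow>
      \<exists>w M. name (s @ u @ w) M \<and> below (s @ u @ w) M A' \<and> Q \<tau> (s @ u @ w) M"
  shows "\<exists>M. name s M \<and> below s M A \<and> (\<forall>\<tau>\<in>T. \<forall>u. \<exists>w. Q \<tau> (s @ u @ w) M)"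
  using assms(1,4)
proof (induction T rule: finite_induct)
  case empty
  then show ?case using A below_refl by blast
next
  case (insert \<tau> T)
  obtain M where M: "name s M" "below s M A" "\<forall>\<tau>\<in>T. \<forall>u. \<exists>w. Q \<tau> (s @ u @ w) M"
    using insert.IH insert.prems by blast
  have "\<exists>M'. name s M' \<and> below s M' M \<and> (\<forall>u. \<exists>w. Q \<tau> (s @ u @ w) M')"
  proof (rule name_mixing[OF M(1) Q])
    fix u A' assume "name (s @ u) A'" "below (s @ u) A' M"
    then show "\<exists>w M. name (s @ u @ w) M \<and> below (s @ u @ w) M A' \<and> Q \<tau> (s @ u @ w) M"
      using insert.prems[of \<tau> u A'] M(2) below_append below_trans by blast
  qed
  then obtain M' where M': "name s M'" "below s M' M" "\<forall>u. \<exists>w. Q \<tau> (s @ u @ w) M'" by blast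
  have "\<exists>w. Q \<tau>' (s @ u @ w) M'" if "\<tau>' \<in> insert \<tau> T" for \<tau>' u
  proof (cases "\<tau>' = \<tau>")
    case False
    then have "\<tau>' \<in> T" using that by simp
    then obtain w where "Q \<tau>' (s @ u @ w) M" using M(3) by meson
    then have "Q \<tau>' (s @ u @ w) M'"
      by (rule heredD2[OF Q _ name_append[OF M'(1)] below_append[OF M'(2)]])
    then show ?thesis ..
  next
    case True
    then show ?thesis using M'(3) by simp
  qed
  then show ?case using M' M(2) below_trans by blast
qed


text \<open>A diagonal intersection of a decreasing sequence of names. The set is built greedily
  along \<open>t\<close>: each new entry of \<open>t\<close> admits at most one number, the least
  one that exceeds all previous choices and lies in all the names they prescribe.\<close>

lemma diagonal_name:
  fixes F :: "nat \<Rightarrow> nat list \<Rightarrow> nat set"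
  assumes F: "\<And>j. name s (F j)" and dec: "\<And>j. below s (F (Suc j)) (F j)"
  shows "\<exists>M. name s M \<and> below s M (F 0) \<and>
    (\<forall>t n m. n \<in> M t \<longrightarrow> m \<in> M t \<longrightarrow> n < m \<longrightarrow> m \<in> F (Suc n) t)"
proof -
  define cand where "cand S t = {n \<in> F 0 t. \<forall>m\<in>S. m < n \<and> n \<in> F (Suc m) t}" for S t
  define add where "add S t = (if cand S t = {} then S else insert (LEAST n. n \<in> cand S t) S)" for S t
  \<comment> \<open>The recursion runs on the reversed list, since \<open>M\<close> has to grow when
    an entry is appended at the end.\<close>
  define cr where "cr = rec_list ({}::nat set) (\<lambda>a l S. add S (rev (a # l)))"
  define M where "M t = cr (rev t)" for t
  have M: "M [] = {}" "M (t @ [a]) = add (M t) (t @ [a])" for t a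
    by (simp_all add: M_def cr_def)
  have add_cases: "add S t = S \<or> (\<exists>n\<in>cand S t. add S t = insert n S)" for S t
    unfolding add_def by (metis LeastI_ex ex_in_conv)
  have M1: "M t \<subseteq> M (t @ [a])" for t a unfolding M using add_cases by blast
  have mono: "M t \<subseteq> M (t @ u)" for t u
  proof (induction u rule: rev_induct)
    case (snoc a u)
    then show ?case using M1[of "t @ u" a] by simp
  qed simp
  have Fm: "n \<in> F j t \<Longrightarrow> n \<in> F j (t @ u)" for n j t u using name_mono[OF F] by blast
  have inv: "finite (M t) \<and> M t \<subseteq> F 0 t \<and> (\<forall>n\<in>M t. \<forall>m\<in>M t. n < m \<longrightarrow> m \<in> F (Suc n) t)" for t
  proof (induction t rule: rev_induct)
    case Nil
    then show ?case by (simp add: M)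
  next
    case (snoc a t)
    have old: "finite (M t)" "M t \<subseteq> F 0 (t @ [a])"
      "\<forall>n\<in>M t. \<forall>m\<in>M t. n < m \<longrightarrow> m \<in> F (Suc n) (t @ [a])" using snoc Fm by blast+
    from add_cases[of "M t" "t @ [a]"] show ?case
    proof
      assume "add (M t) (t @ [a]) = M t"
      then show ?thesis using old by (simp add: M)
    next
      assume "\<exists>n\<in>cand (M t) (t @ [a]). add (M t) (t @ [a]) = insert n (M t)"
      then obtain n where n: "n \<in> cand (M t) (t @ [a])" "M (t @ [a]) = insert n (M t)"
        by (auto simp: M)
      then have "n \<in> F 0 (t @ [a])" "\<forall>m\<in>M t. m < n \<and> n \<in> F (Suc m) (t @ [a])"
        by (auto simp: cand_def)
      then show ?thesis unfolding n(2) using old by fastforce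
    qed
  qed
  have decr: "j \<le> j' \<Longrightarrow> F j' (s @ u) \<subseteq> F j (s @ u)" for j j' u
  proof (induction j' rule: dec_induct)
    case (step j')
    then show ?case using dec[of j'] unfolding below_def by blast
  qed simp
  have unb: "\<exists>w. \<exists>n\<in>M (s @ u @ w). m \<le> n" for u m
  proof -
    \<comment> \<open>If \<open>M\<close> stopped growing, its finite value would have a strict
      bound \<open>b\<close>. An element of \<open>F b\<close> that is at least \<open>b\<close>
      lies in all earlier \<open>F j\<close>, and \<open>Suc m\<close> is at most \<open>b\<close>
      for every \<open>m\<close> in \<open>M\<close>, so this element is a candidate at the next
      node; the entry \<open>[0]\<close> provides that node.\<close>
    have grow: "\<exists>w. M (s @ u) \<subset> M (s @ u @ w)" for u
    proof (rule ccontr)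
      assume "\<not> ?thesis"
      then have const: "M (s @ u @ w) = M (s @ u)" for w using mono[of "s @ u" w] by auto
      obtain b where b: "\<forall>m\<in>M (s @ u). m < b" using inv finite_nat_set_iff_bounded by blast
      obtain w n where n: "n \<in> F b (s @ u @ w)" "b \<le> n" using name_unbounded[OF F] by blast
      have "n \<in> F j (s @ u @ w @ [0])" if "j \<le> b" for j
        using decr[OF that, of "u @ w @ [0]"] Fm[OF n(1), of "[0]"] by auto
      then have "n \<in> cand (M (s @ u @ w)) (s @ u @ w @ [0])"
        unfolding cand_def const using b n(2) by (auto simp: Suc_le_eq)
      then have ne: "cand (M (s @ u @ w)) (s @ u @ w @ [0]) \<noteq> {}" by blast
      have "M ((s @ u @ w) @ [0]) = add (M (s @ u @ w)) ((s @ u @ w) @ [0])" by (rule M)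
      then obtain n' where n': "n' \<in> cand (M (s @ u @ w)) (s @ u @ w @ [0])"
        "M (s @ u @ w @ [0]) = insert n' (M (s @ u @ w))"
        using ne LeastI_ex[of "\<lambda>n. n \<in> cand (M (s @ u @ w)) (s @ u @ w @ [0])"] by (auto simp: add_def)
      then have "n' \<notin> M (s @ u @ w)" unfolding cand_def by blast
      then show False using n'(2) const[of w] const[of "w @ [0]"] by auto
    qed
    have "\<exists>w. card (M (s @ u @ w)) \<ge> k" for k
    proof (induction k)
      case (Suc k)
      then obtain w where w: "card (M (s @ u @ w)) \<ge> k" by blast
      obtain z where "M (s @ u @ w) \<subset> M (s @ (u @ w) @ z)" using grow[of "u @ w"] by auto
      then have "card (M (s @ u @ w)) < card (M (s @ (u @ w) @ z))" using inv psubset_card_mono by blast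
      then have "card (M (s @ u @ (w @ z))) \<ge> Suc k" using w by simp
      then show ?case by blast
    qed simp
    then obtain w where "card (M (s @ u @ w)) \<ge> Suc m" by blast
    then have "\<not> M (s @ u @ w) \<subseteq> {..<m}"
      by (metis card_lessThan card_mono finite_lessThan not_less_eq_eq)
    then show ?thesis by (meson lessThan_iff not_le subsetI)
  qed
  have "name s M" unfolding name_def using mono unb by blast
  moreover have "below s M (F 0)" unfolding below_def using inv by blast
  ultimately show ?thesis using inv by blast
qed

text \<open>Stage \<open>j\<close> meets the finitely many requirements with
  \<open>i \<le> j\<close> and stem inside \<open>{..<j}\<close>. Once \<open>n\<close> is in the
  diagonal intersection of the stages, its part beyond \<open>n\<close> lies inside stage
  \<open>Suc n\<close>, where the requirements for all stems inside \<open>{..n}\<close> have been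
  met.\<close>

lemma fusion:
  fixes Q :: "nat \<Rightarrow> nat \<Rightarrow> nat set \<Rightarrow> nat list \<Rightarrow> (nat list \<Rightarrow> nat set) \<Rightarrow> bool"
  assumes A: "name s A" and Q: "\<And>i m e. hered (Q i m e)"
    and dense: "\<And>i m e u A'. e \<subseteq> {..<m} \<Longrightarrow> name (s @ u) A' \<Longrightarrow> below (s @ u) A' A \<Longrightarrow>
      \<exists>w M. name (s @ u @ w) M \<and> below (s @ u @ w) M A' \<and> Q i m e (s @ u @ w) M"
  shows "\<exists>M. name s M \<and> below s M A \<and>
    (\<forall>i n e u. n \<in> M (s @ u) \<longrightarrow> i \<le> n \<longrightarrow> e \<subseteq> {..n} \<longrightarrow>
       (\<exists>w. Q i (Suc n) e (s @ u @ w) (trim (Suc n) M)))"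
proof -
  define T where "T j = {(i, e). i \<le> j \<and> e \<subseteq> {..<j}}" for j :: nat
  define \<Theta> where "\<Theta> j M \<longleftrightarrow> (\<forall>(i, e)\<in>T j. \<forall>u. \<exists>w. Q i j e (s @ u @ w) M)" for j M
  have step: "\<exists>M. name s M \<and> below s M A' \<and> \<Theta> j M" if A': "name s A'" "below s A' A" for j A'
  proof -
    have "finite (T j)"
      by (rule finite_subset[of _ "{..j} \<times> Pow {..<j}"]) (auto simp: T_def)
    then have "\<exists>M. name s M \<and> below s M A' \<and>
        (\<forall>\<tau>\<in>T j. \<forall>u. \<exists>w. (\<lambda>(i, e). Q i j e) \<tau> (s @ u @ w) M)"
    proof (rule finite_name_mixing[OF _ A'(1)])
      show "hered ((\<lambda>(i, e). Q i j e) \<tau>)" for \<tau> using Q by (cases \<tau>) simp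
    next
      fix \<tau> u A''
      assume t: "\<tau> \<in> T j" and n: "name (s @ u) A''" and b: "below (s @ u) A'' A'"
      obtain i e where \<tau>: "\<tau> = (i, e)" by (cases \<tau>)
      have e: "e \<subseteq> {..<j}" using t by (auto simp: T_def \<tau>)
      show "\<exists>w M. name (s @ u @ w) M \<and> below (s @ u @ w) M A'' \<and> (\<lambda>(i, e). Q i j e) \<tau> (s @ u @ w) M"
        using dense[OF e n below_trans[OF b below_append[OF A'(2)]], of i] by (simp add: \<tau>)
    qed
    then show ?thesis unfolding \<Theta>_def by (fastforce simp: split_def)
  qed
  define nxt where "nxt j A' = (SOME M. name s M \<and> below s M A' \<and> \<Theta> j M)" for j A'
  have nxt: "name s (nxt j A') \<and> below s (nxt j A') A' \<and> \<Theta> j (nxt j A')"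
    if "name s A'" "below s A' A" for j A' unfolding nxt_def by (rule someI_ex[OF step[OF that]])
  define F where "F = rec_nat (nxt 0 A) (\<lambda>j. nxt (Suc j))"
  have F: "F 0 = nxt 0 A" "F (Suc j) = nxt (Suc j) (F j)" for j by (simp_all add: F_def)
  have FA: "name s (F j) \<and> below s (F j) A \<and> \<Theta> j (F j)" for j
  proof (induction j)
    case 0
    then show ?case using nxt[OF A below_refl] by (simp add: F)
  next
    case (Suc j)
    then show ?case using nxt[of "F j" "Suc j"] below_trans by (auto simp: F)
  qed
  have "below s (F (Suc j)) (F j)" for j using nxt[of "F j" "Suc j"] FA[of j] by (simp add: F)
  then obtain M where M: "name s M" "below s M (F 0)"
    "\<And>t n m. n \<in> M t \<Longrightarrow> m \<in> M t \<Longrightarrow> n < m \<Longrightarrow> m \<in> F (Suc n) t"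
    using diagonal_name[of s F] FA by blast
  have "\<exists>w. Q i (Suc n) e (s @ u @ w) (trim (Suc n) M)"
    if n: "n \<in> M (s @ u)" and i: "i \<le> n" and e: "e \<subseteq> {..n}" for i n e u
  proof -
    have "(i, e) \<in> T (Suc n)" using i e by (auto simp: T_def lessThan_Suc_atMost)
    then obtain w where w: "Q i (Suc n) e (s @ u @ w) (F (Suc n))"
      using FA[of "Suc n"] unfolding \<Theta>_def by blast
    have "below (s @ u @ w) (trim (Suc n) M) (F (Suc n))"
      unfolding below_def
    proof (intro allI subsetI)
      fix z m assume m: "m \<in> trim (Suc n) M ((s @ u @ w) @ z)"
      have "n \<in> M ((s @ u @ w) @ z)" using name_mono[OF M(1), of "s @ u" "w @ z"] n by auto
      then show "m \<in> F (Suc n) ((s @ u @ w) @ z)" using M(3) m by (auto simp: trim_def)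
    qed
    moreover have "name (s @ u @ w) (trim (Suc n) M)" by (rule name_append[OF name_trim[OF M(1)]])
    ultimately show ?thesis using heredD2[OF Q w] by blast
  qed
  then show ?thesis using M(1,2) FA[of 0] below_trans by blast
qed

text \<open>Requirements met at densely many nodes are met along a generic point, because there are
  only countably many triples; heredity extends them from one initial segment to all longer
  ones.\<close>

lemma fusion_generic:
  assumes "name s M" and Q: "\<And>i m e. hered (Q i m e)"
    and fus: "\<And>i n e u. n \<in> M (s @ u) \<Longrightarrow> i \<le> n \<Longrightarrow> e \<subseteq> {..n} \<Longrightarrow>
       \<exists>w. Q i (Suc n) e (s @ u @ w) (trim (Suc n) M)"
  shows "forces s (\<lambda>x. \<forall>(i::nat) n e. n \<in> ev M x \<longrightarrow> i \<le> n \<longrightarrow> e \<subseteq> {..n} \<longrightarrow>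
       (\<exists>k. \<forall>l\<ge>k. Q i (Suc n) e (ini x l) (trim (Suc n) M)))"
proof -
  have "forces s (\<lambda>x. \<forall>p\<in>{p::nat \<times> nat \<times> nat set. finite (snd (snd p))}.
    case p of (i, n, e) \<Rightarrow> i \<le> n \<longrightarrow> e \<subseteq> {..n} \<longrightarrow>
      (\<forall>k. n \<in> M (ini x k) \<longrightarrow> (\<exists>l. Q i (Suc n) e (ini x l) (trim (Suc n) M))))"
  proof (rule forces_ball)
    have "{p::nat \<times> nat \<times> nat set. finite (snd (snd p))} = UNIV \<times> UNIV \<times> {e. finite e}" by auto
    then show "countable {p::nat \<times> nat \<times> nat set. finite (snd (snd p))}"
      by (simp add: countable_Collect_finite)
  next
    fix p :: "nat \<times> nat \<times> nat set"
    obtain i n e where p: "p = (i, n, e)" by (cases p)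
    show "forces s (\<lambda>x. case p of (i, n, e) \<Rightarrow> i \<le> n \<longrightarrow> e \<subseteq> {..n} \<longrightarrow>
      (\<forall>k. n \<in> M (ini x k) \<longrightarrow> (\<exists>l. Q i (Suc n) e (ini x l) (trim (Suc n) M))))"
    proof (cases "i \<le> n \<and> e \<subseteq> {..n}")
      case True
      \<comment> \<open>A node of \<open>U\<close> settles the requirement or excludes
        \<open>n\<close> for good. For a point whose value contains \<open>n\<close>, only the first
        alternative can occur.\<close>
      define U where "U = {t. Q i (Suc n) e t (trim (Suc n) M) \<or> (\<forall>w. n \<notin> M (t @ w))}"
      have "forces s (\<lambda>x. \<exists>k. ini x k \<in> U)"
      proof (rule forces_meets)
        fix u
        show "\<exists>w. s @ u @ w \<in> U"
        proof (cases "\<exists>w. n \<in> M (s @ u @ w)")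
          case t: True
          then obtain w where w: "n \<in> M (s @ u @ w)" by blast
          obtain z where "Q i (Suc n) e (s @ (u @ w) @ z) (trim (Suc n) M)"
            using fus[of n "u @ w" i e] w True by auto
          then have "s @ u @ (w @ z) \<in> U" by (simp add: U_def)
          then show ?thesis by blast
        next
          case False
          then have "s @ u @ [] \<in> U" by (simp add: U_def)
          then show ?thesis by blast
        qed
      qed
      then show ?thesis
      proof (rule forces_mono)
        fix x assume "\<exists>k. ini x k \<in> U"
        then obtain k where k: "ini x k \<in> U" by blast
        have "\<exists>l. Q i (Suc n) e (ini x l) (trim (Suc n) M)" if n: "n \<in> M (ini x k')" for k'
        proof -
          obtain w where w: "ini x (max k k') = ini x k @ w" using ini_le[of k "max k k'"] by auto
          have "n \<in> M (ini x k @ w)" using n name_mono_ini[OF assms(1), of k' "max k k'" x] w by auto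
          then show ?thesis using k by (auto simp: U_def)
        qed
        then show "case p of (i, n, e) \<Rightarrow> i \<le> n \<longrightarrow> e \<subseteq> {..n} \<longrightarrow>
      (\<forall>k. n \<in> M (ini x k) \<longrightarrow> (\<exists>l. Q i (Suc n) e (ini x l) (trim (Suc n) M)))" by (auto simp: p)
      qed
    qed (auto simp: p intro: forces_trivial)
  qed
  then show ?thesis
  proof (rule forces_mono, intro allI impI)
    fix x i n e
    assume *: "\<forall>p\<in>{p::nat \<times> nat \<times> nat set. finite (snd (snd p))}.
      case p of (i, n, e) \<Rightarrow> i \<le> n \<longrightarrow> e \<subseteq> {..n} \<longrightarrow>
      (\<forall>k. n \<in> M (ini x k) \<longrightarrow> (\<exists>l. Q i (Suc n) e (ini x l) (trim (Suc n) M)))"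
      and n: "n \<in> ev M x" and i: "i \<le> n" and e: "e \<subseteq> {..n}"
    have "finite e" using e finite_subset by blast
    then obtain l where l: "Q i (Suc n) e (ini x l) (trim (Suc n) M)"
      using bspec[OF *, of "(i, n, e)"] n i e by (auto simp: ev_def)
    have "Q i (Suc n) e (ini x l') (trim (Suc n) M)" if "l \<le> l'" for l'
      using heredD1[OF Q l] ini_le[OF that, of x] by metis
    then show "\<exists>k. \<forall>l\<ge>k. Q i (Suc n) e (ini x l) (trim (Suc n) M)" by blast
  qed
qed

lemma generic_fusion:
  fixes Q :: "nat \<Rightarrow> nat \<Rightarrow> nat set \<Rightarrow> nat list \<Rightarrow> (nat list \<Rightarrow> nat set) \<Rightarrow> bool"
  assumes A: "name s A" and Q: "\<And>i m e. hered (Q i m e)"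
    and dense: "\<And>i m e u A'. e \<subseteq> {..<m} \<Longrightarrow> name (s @ u) A' \<Longrightarrow> below (s @ u) A' A \<Longrightarrow>
      \<exists>w M. name (s @ u @ w) M \<and> below (s @ u @ w) M A' \<and> Q i m e (s @ u @ w) M"
  obtains M where "name s M" "below s M A"
    "forces s (\<lambda>x. \<forall>i n e. n \<in> ev M x \<longrightarrow> i \<le> n \<longrightarrow> e \<subseteq> {..n} \<longrightarrow>
       (\<exists>k. \<forall>l\<ge>k. Q i (Suc n) e (ini x l) (trim (Suc n) M)))"
proof -
  have "\<exists>M. name s M \<and> below s M A \<and>
    (\<forall>i n e u. n \<in> M (s @ u) \<longrightarrow> i \<le> n \<longrightarrow> e \<subseteq> {..n} \<longrightarrow>
       (\<exists>w. Q i (Suc n) e (s @ u @ w) (trim (Suc n) M)))"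
    by (rule fusion[OF A Q]) (fact dense)
  then obtain M where M: "name s M" "below s M A"
    "\<And>i n e u. n \<in> M (s @ u) \<Longrightarrow> i \<le> n \<Longrightarrow> e \<subseteq> {..n} \<Longrightarrow>
       \<exists>w. Q i (Suc n) e (s @ u @ w) (trim (Suc n) M)"
    by meson
  show thesis by (rule that[OF M(1,2)]) (rule fusion_generic[OF M(1) Q M(3)])
qed

lemma name_ini: "name s M \<Longrightarrow> x \<in> cyl s \<Longrightarrow> length s \<le> l \<Longrightarrow> name (ini x l) M"
  using cyl_ini_ge[of x s l] name_append by auto

lemma below_ini: "below s M A \<Longrightarrow> x \<in> cyl s \<Longrightarrow> length s \<le> l \<Longrightarrow> below (ini x l) M A"
  using cyl_ini_ge[of x s l] below_append by auto

section \<open>Uniformly Ramsey relations\<close>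

text \<open>The basic Ellentuck neighbourhood with stem \<open>e\<close> and tail in
  \<open>L\<close>. The length \<open>m\<close> of the stem is a separate parameter because
  \<open>e\<close> alone does not say up to where the set has been fixed.\<close>

definition nb :: "nat \<Rightarrow> nat set \<Rightarrow> nat set \<Rightarrow> nat set set" where
  "nb m e L = {N. infinite N \<and> N \<inter> {..<m} = e \<and> N \<inter> {m..} \<subseteq> L}"

lemma nb_mono: "L \<subseteq> L' \<Longrightarrow> nb m e L \<subseteq> nb m e L'"
  by (auto simp: nb_def)

lemma nb_next:
  "N \<in> nb m e L \<Longrightarrow> m \<le> n \<Longrightarrow> L \<subseteq> L' \<Longrightarrow> N \<in> nb (Suc n) (N \<inter> {..n}) (L' \<inter> {Suc n..})"
  by (auto simp: nb_def)

lemma nb_unbounded: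
  assumes "N \<in> nb m e L"
  shows "\<exists>n\<in>N. k \<le> n"
  using assms by (auto simp: nb_def infinite_nat_iff_unbounded_le)

lemma nb_least:
  assumes "N \<in> nb m e L" "n \<in> N" "m \<le> n" "N \<inter> {m..<n} = {}"
  shows "N \<inter> {..n} = insert n e"
proof -
  have "{..n} = insert n ({..<m} \<union> {m..<n})" using assms(3) by auto
  then show ?thesis using assms by (auto simp: nb_def)
qed

definition inside :: "nat \<Rightarrow> nat set \<Rightarrow> ((nat \<Rightarrow> nat) \<Rightarrow> nat set set) \<Rightarrow> nat list \<Rightarrow> (nat list \<Rightarrow> nat set) \<Rightarrow> bool" where
  "inside m e Y r M \<longleftrightarrow> forces r (\<lambda>x. nb m e (ev M x) \<subseteq> Y x)"

text \<open>Complete Ramseyness in the sense of Ellentuck, with a generic point \<open>x\<close> as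
  parameter and names in place of infinite sets. A refinement may also lengthen the condition, so
  the decision may depend on an initial segment of \<open>x\<close>.\<close>

definition UR :: "((nat \<Rightarrow> nat) \<Rightarrow> nat set set) \<Rightarrow> bool" where
  "UR Y \<longleftrightarrow> (\<forall>m e s A. e \<subseteq> {..<m} \<longrightarrow> name s A \<longrightarrow> (\<exists>u M. name (s @ u) M \<and> below (s @ u) M A \<and>
     (inside m e Y (s @ u) M \<or> inside m e (\<lambda>x. - Y x) (s @ u) M)))"

text \<open>Negation in the sense of forcing, which makes having \<open>P\<close> or being blocked
  an alternative that can always be decided by a refinement.\<close>

definition blocked :: "(nat list \<Rightarrow> (nat list \<Rightarrow> nat set) \<Rightarrow> bool) \<Rightarrow> nat list \<Rightarrow> (nat list \<Rightarrow> nat set) \<Rightarrow> bool" where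
  "blocked P r M \<longleftrightarrow> (\<forall>u M'. name (r @ u) M' \<longrightarrow> below (r @ u) M' M \<longrightarrow> \<not> P (r @ u) M')"

lemma hered_forces:
  assumes "\<And>x L L'. P x L \<Longrightarrow> L' \<subseteq> L \<Longrightarrow> P x L'"
  shows "hered (\<lambda>r M. forces r (\<lambda>x. P x (ev M x)))"
  unfolding hered_def
proof (intro conjI allI impI)
  fix r M M' assume f: "forces r (\<lambda>x. P x (ev M x))" and M': "name r M'" "below r M' M"
  show "forces r (\<lambda>x. P x (ev M' x))"
    using f by (rule forces_mono) (rule assms[OF _ ev_below[OF M']])
qed (rule forces_append)

lemma hered_inside: "hered (inside m e Y)"
  unfolding inside_def
  by (rule hered_forces[where P = "\<lambda>x L. nb m e L \<subseteq> Y x"]) (rule order_trans[OF nb_mono])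

lemma hered_blocked: "hered (blocked P)"
  unfolding hered_def
proof (intro conjI allI impI)
  fix r M u assume "blocked P r M"
  then show "blocked P (r @ u) M" unfolding blocked_def by simp
next
  fix r M M' assume *: "blocked P r M" "below r M' M"
  show "blocked P r M'" unfolding blocked_def
  proof (intro allI impI)
    fix u M'' assume **: "name (r @ u) M''" "below (r @ u) M'' M'"
    then have "below (r @ u) M'' M" using below_trans[OF **(2) below_append[OF *(2)]] by simp
    then show "\<not> P (r @ u) M''" using *(1) **(1) unfolding blocked_def by blast
  qed
qed

lemma blockedD:
  assumes "blocked P (ini x k) M" "k \<le> l" "name (ini x l) M'" "below (ini x l) M' M"
  shows "\<not> P (ini x l) M'"
proof -
  obtain u where u: "ini x l = ini x k @ u" using ini_le[OF assms(2), of x] by blast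
  show ?thesis using assms(1,3,4) unfolding u blocked_def by blast
qed

lemma decided_dense:
  assumes "name r A"
  shows "\<exists>w M. name (r @ w) M \<and> below (r @ w) M A \<and> (P (r @ w) M \<or> blocked P (r @ w) M)"
proof (cases "blocked P r A")
  case True
  then show ?thesis using assms by (intro exI[of _ "[]"] exI[of _ A]) simp
next
  case False
  then show ?thesis unfolding blocked_def by blast
qed

section \<open>Open relations are uniformly Ramsey\<close>

definition open_rel :: "((nat \<Rightarrow> nat) \<Rightarrow> nat set set) \<Rightarrow> bool" where
  "open_rel G \<longleftrightarrow> (\<forall>x. \<forall>N\<in>G x. infinite N \<longrightarrow> (\<exists>k m. \<forall>x'\<in>cyl (ini x k). \<forall>N'.
     infinite N' \<longrightarrow> N' \<inter> {..<m} = N \<inter> {..<m} \<longrightarrow> N' \<in> G x'))"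

text \<open>The combinatorial forcing of Nash-Williams, carried out for names. A stem is accepted if
  its neighbourhood is forced into \<open>G\<close>, and rejected if no refinement accepts it. If
  the initial stem is rejected, two fusions yield a name such that, at generic points, every stem
  occurring in the neighbourhood is rejected. Openness would make a long stem of a member of
  \<open>G\<close> accepted, so the neighbourhood misses \<open>G\<close>.\<close>

lemma UR_open:
  assumes G: "open_rel G"
  shows "UR G"
  unfolding UR_def
proof (intro allI impI)
  fix m0 :: nat and e0 :: "nat set" and s A
  assume e0: "e0 \<subseteq> {..<m0}" and A: "name s A"
  define acc where "acc m e = inside m e G" for m e
  define bad where "bad m e = blocked (acc m e)" for m e
  have hacc: "hered (acc m e)" and hbad: "hered (bad m e)" for m e
    by (simp_all add: acc_def bad_def hered_inside hered_blocked)
  show "\<exists>u M. name (s @ u) M \<and> below (s @ u) M A \<and>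
     (inside m0 e0 G (s @ u) M \<or> inside m0 e0 (\<lambda>x. - G x) (s @ u) M)"
  proof (cases "bad m0 e0 s A")
    case False
    then show ?thesis unfolding bad_def blocked_def acc_def by blast
  next
    case blk: True
    \<comment> \<open>First fusion: every stem up to an element of \<open>M1\<close> becomes
      accepted or rejected with respect to the rest of \<open>M1\<close>.\<close>
    obtain M1 where M1: "name s M1" "below s M1 A"
      and g1: "forces s (\<lambda>x. \<forall>i n e. n \<in> ev M1 x \<longrightarrow> i \<le> n \<longrightarrow> e \<subseteq> {..n} \<longrightarrow>
       (\<exists>k. \<forall>l\<ge>k. acc (Suc n) e (ini x l) (trim (Suc n) M1) \<or> bad (Suc n) e (ini x l) (trim (Suc n) M1)))"
    proof (rule generic_fusion[OF A, of "\<lambda>i m e r M. acc m e r M \<or> bad m e r M"])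
      show "hered (\<lambda>r M. acc m e r M \<or> bad m e r M)" for m e by (rule hered_disj[OF hacc hbad])
      show "\<exists>w M. name (s @ u @ w) M \<and> below (s @ u @ w) M A' \<and> (acc m e (s @ u @ w) M \<or> bad m e (s @ u @ w) M)"
        if "name (s @ u) A'" for m e u A'
        using decided_dense[OF that, of "acc m e"] by (simp add: bad_def)
    qed blast
    define good where "good n e x \<longleftrightarrow> (\<exists>k. bad (Suc n) e (ini x k) (trim (Suc n) M1))" for n e x
    \<comment> \<open>The aim is that a stem which is not accepted has all its one-point extensions
      from \<open>M\<close> rejected.\<close>
    define Q where "Q m e r M \<longleftrightarrow> acc m e r M \<or>
      forces r (\<lambda>x. \<forall>n\<in>ev M x. m \<le> n \<longrightarrow> good n (insert n e) x)" for m e r M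
    have hQ: "hered (Q m e)" for m e
      unfolding Q_def by (intro hered_disj hacc hered_forces[where P="\<lambda>x L. \<forall>n\<in>L. m \<le> n \<longrightarrow> good n (insert n e) x"]) blast
    have dQ: "\<exists>w M. name (s @ u @ w) M \<and> below (s @ u @ w) M A' \<and> Q m e (s @ u @ w) M"
      if e: "e \<subseteq> {..<m}" and A': "name (s @ u) A'" "below (s @ u) A' M1" for m e u A'
    proof (cases "\<exists>w M. name (s @ u @ w) M \<and> below (s @ u @ w) M A' \<and> acc m e (s @ u @ w) M")
      case True
      then show ?thesis unfolding Q_def by blast
    next
      case noacc: False
      \<comment> \<open>\<open>K\<close> collects the \<open>n\<close> for which some initial
        segment of the node accepts the stem extended by \<open>n\<close>. If \<open>K\<close> were
        a name, it would accept \<open>e\<close>: a set in the neighbourhood lies in that of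
        \<open>insert n e\<close>, where \<open>n\<close> is its first element after the
        stem.\<close>
      define K where "K t = {n \<in> A' t. m \<le> n \<and>
        (\<exists>k\<le>length t. acc (Suc n) (insert n e) (take k t) (trim (Suc n) M1))}" for t
      have Kmono: "K t \<subseteq> K (t @ v)" for t v
      proof
        fix n assume "n \<in> K t"
        then obtain k where k: "n \<in> A' t" "m \<le> n" "k \<le> length t"
          "acc (Suc n) (insert n e) (take k t) (trim (Suc n) M1)" by (auto simp: K_def)
        have "n \<in> A' (t @ v)" using name_mono[OF A'(1), of t v] k(1) by blast
        moreover have "take k (t @ v) = take k t" "k \<le> length (t @ v)" using k(3) by simp_all
        ultimately show "n \<in> K (t @ v)" unfolding K_def using k(2,4) by auto
      qed
      have KA: "below r K A'" for r unfolding below_def K_def by blast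
      have "\<not> name (s @ u) K"
      proof
        assume K: "name (s @ u) K"
        have "forces (s @ u) (\<lambda>x. \<forall>n\<in>UNIV. \<forall>k. forces (ini x k) (\<lambda>x. nb (Suc n) (insert n e) (ev (trim (Suc n) M1) x) \<subseteq> G x)
          \<longrightarrow> nb (Suc n) (insert n e) (ev (trim (Suc n) M1) x) \<subseteq> G x)"
          by (rule forces_self) simp
        then have "forces (s @ u) (\<lambda>x. nb m e (ev K x) \<subseteq> G x)"
        proof (rule forces_mono, intro subsetI)
          fix x N
          assume x: "x \<in> cyl (s @ u)"
            and self: "\<forall>n\<in>UNIV. \<forall>k. forces (ini x k) (\<lambda>x. nb (Suc n) (insert n e) (ev (trim (Suc n) M1) x) \<subseteq> G x)
          \<longrightarrow> nb (Suc n) (insert n e) (ev (trim (Suc n) M1) x) \<subseteq> G x"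
            and N: "N \<in> nb m e (ev K x)"
          define n where "n = (LEAST n. n \<in> N \<and> m \<le> n)"
          have n: "n \<in> N" "m \<le> n" using LeastI_ex[of "\<lambda>n. n \<in> N \<and> m \<le> n"] nb_unbounded[OF N, of m]
            unfolding n_def by blast+
          have emp: "N \<inter> {m..<n} = {}" using not_less_Least[of _ "\<lambda>n. n \<in> N \<and> m \<le> n"] unfolding n_def by fastforce
          have "n \<in> ev K x" using N n by (auto simp: nb_def)
          then obtain k where "n \<in> K (ini x k)" by (auto simp: ev_def)
          then obtain j where "j \<le> k" "acc (Suc n) (insert n e) (take j (ini x k)) (trim (Suc n) M1)"
            by (auto simp: K_def)
          then have "acc (Suc n) (insert n e) (ini x j) (trim (Suc n) M1)" by (simp add: take_ini)
          then have sub: "nb (Suc n) (insert n e) (ev (trim (Suc n) M1) x) \<subseteq> G x"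
            using self unfolding acc_def inside_def by blast
          have "ev K x \<subseteq> ev M1 x"
            using ev_below[OF K KA x] ev_below[OF A' x] by blast
          then have "N \<in> nb (Suc n) (insert n e) (ev (trim (Suc n) M1) x)"
            using nb_next[OF N n(2)] nb_least[OF N n emp] by (simp add: ev_trim)
          then show "N \<in> G x" using sub by blast
        qed
        then have "acc m e (s @ u @ []) K" by (simp add: acc_def inside_def)
        moreover have "name (s @ u @ []) K" using K by simp
        ultimately show False using noacc KA by blast
      qed
      \<comment> \<open>\<open>K\<close> is monotone, so it fails to be a name by being bounded on
        all extensions of some node. Beyond the bound no one-point extension is accepted, and the
        first fusion leaves only rejection.\<close>
      then have "\<exists>v b. \<forall>z. \<forall>n\<in>K (s @ u @ v @ z). n < b"
        unfolding name_def using Kmono by (simp add: not_le)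
      then obtain v b where vb: "\<And>z n. n \<in> K (s @ u @ v @ z) \<Longrightarrow> n < b" by blast
      have "forces (s @ u @ v) (\<lambda>x. \<forall>n\<in>ev (trim b A') x. m \<le> n \<longrightarrow> good n (insert n e) x)"
        using forces_append[OF g1, of "u @ v"]
      proof (rule forces_mono, intro ballI impI)
        fix x n
        assume x: "x \<in> cyl (s @ u @ v)"
          and gx: "\<forall>i n e. n \<in> ev M1 x \<longrightarrow> i \<le> n \<longrightarrow> e \<subseteq> {..n} \<longrightarrow>
       (\<exists>k. \<forall>l\<ge>k. acc (Suc n) e (ini x l) (trim (Suc n) M1) \<or> bad (Suc n) e (ini x l) (trim (Suc n) M1))"
          and n: "n \<in> ev (trim b A') x" "m \<le> n"
        have xu: "x \<in> cyl (s @ u)" using x cyl_append[of x "s @ u" v] by simp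
        have nA: "n \<in> ev A' x" "b \<le> n" using n by (auto simp: ev_trim)
        then have "n \<in> ev M1 x" using ev_below[OF A' xu] by blast
        moreover have "insert n e \<subseteq> {..n}" using e n(2) by auto
        ultimately obtain k where k: "\<forall>l\<ge>k. acc (Suc n) (insert n e) (ini x l) (trim (Suc n) M1)
            \<or> bad (Suc n) (insert n e) (ini x l) (trim (Suc n) M1)" using gx by blast
        show "good n (insert n e) x"
        proof (rule ccontr)
          assume "\<not> good n (insert n e) x"
          then have ac: "acc (Suc n) (insert n e) (ini x k) (trim (Suc n) M1)"
            using k unfolding good_def by blast
          obtain k' where k': "n \<in> A' (ini x k')" using nA by (auto simp: ev_def)
          let ?l = "k + k' + length (s @ u @ v)"
          have "n \<in> A' (ini x ?l)" using k' name_mono_ini[OF A'(1), of k' ?l x] by auto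
          moreover have "take k (ini x ?l) = ini x k" by (simp add: take_ini)
          ultimately have nK: "n \<in> K (ini x ?l)" unfolding K_def using ac n(2) by (auto intro!: exI[of _ k])
          obtain z where "ini x ?l = (s @ u @ v) @ z" using cyl_ini_ge[OF x, of ?l] by auto
          then have "n < b" using vb[of n z] nK by simp
          then show False using nA(2) by simp
        qed
      qed
      then have "Q m e (s @ u @ v) (trim b A')" by (simp add: Q_def)
      moreover have "name (s @ u @ v) (trim b A')" using name_trim[OF name_append[OF A'(1), of v]] by simp
      ultimately show ?thesis using below_trim by blast
    qed
    obtain w A1 where A1: "name (s @ w) A1" "below (s @ w) A1 M1" "Q m0 e0 (s @ w) A1"
      using dQ[OF e0, of "[]" M1] M1(1) by auto
    have A1A: "below (s @ w) A1 A" using below_trans[OF A1(2) below_append[OF M1(2)]] .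
    have "\<not> acc m0 e0 (s @ w) A1" using blk A1(1) A1A unfolding bad_def blocked_def by blast
    then have h0: "forces (s @ w) (\<lambda>x. \<forall>n\<in>ev A1 x. m0 \<le> n \<longrightarrow> good n (insert n e0) x)"
      using A1(3) unfolding Q_def by blast
    \<comment> \<open>Second fusion: \<open>Q\<close> now holds for every stem up to an element of
      \<open>M2\<close>, so rejection passes from such a stem to its one-point extensions.\<close>
    obtain M2 where M2: "name (s @ w) M2" "below (s @ w) M2 A1"
      and g2: "forces (s @ w) (\<lambda>x. \<forall>i n e. n \<in> ev M2 x \<longrightarrow> i \<le> n \<longrightarrow> e \<subseteq> {..n} \<longrightarrow>
       (\<exists>k. \<forall>l\<ge>k. Q (Suc n) e (ini x l) (trim (Suc n) M2)))"
    proof (rule generic_fusion[OF A1(1), of "\<lambda>i. Q"])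
      show "hered (Q m e)" for m e by (rule hQ)
      show "\<exists>w' M. name ((s @ w) @ u @ w') M \<and> below ((s @ w) @ u @ w') M A' \<and> Q m e ((s @ w) @ u @ w') M"
        if "e \<subseteq> {..<m}" "name ((s @ w) @ u) A'" "below ((s @ w) @ u) A' A1" for m e u A'
        using dQ[OF that(1), of "w @ u" A'] that(2) below_trans[OF that(3) below_append[OF A1(2)]] by simp
    qed blast
    have M21: "below (s @ w) M2 M1" using below_trans[OF M2(2) A1(2)] .
    have "forces (s @ w) (\<lambda>x. \<forall>i e k. finite e \<longrightarrow>
        forces (ini x k) (\<lambda>x. \<forall>n\<in>ev (trim (Suc i) M2) x. Suc i \<le> n \<longrightarrow> good n (insert n e) x)
        \<longrightarrow> (\<forall>n\<in>ev (trim (Suc i) M2) x. Suc i \<le> n \<longrightarrow> good n (insert n e) x))"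
      by (rule forces_self_finite_sets)
    from forces_conj[OF forces_conj[OF h0 g2] this]
    have "forces (s @ w) (\<lambda>x. nb m0 e0 (ev M2 x) \<subseteq> - G x)"
    proof (rule forces_mono, intro subsetI)
      fix x N
      assume x: "x \<in> cyl (s @ w)"
        and all: "((\<forall>n\<in>ev A1 x. m0 \<le> n \<longrightarrow> good n (insert n e0) x) \<and>
          (\<forall>i n e. n \<in> ev M2 x \<longrightarrow> i \<le> n \<longrightarrow> e \<subseteq> {..n} \<longrightarrow>
            (\<exists>k. \<forall>l\<ge>k. Q (Suc n) e (ini x l) (trim (Suc n) M2)))) \<and>
          (\<forall>i e k. finite e \<longrightarrow>
            forces (ini x k) (\<lambda>x. \<forall>n\<in>ev (trim (Suc i) M2) x. Suc i \<le> n \<longrightarrow> good n (insert n e) x)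
            \<longrightarrow> (\<forall>n\<in>ev (trim (Suc i) M2) x. Suc i \<le> n \<longrightarrow> good n (insert n e) x))"
        and N: "N \<in> nb m0 e0 (ev M2 x)"
      note a1 = conjunct1[OF conjunct1[OF all]] and a2 = conjunct2[OF conjunct1[OF all]]
        and a3 = conjunct2[OF all]
      have inM2: "n \<in> ev M2 x" if "n \<in> N" "m0 \<le> n" for n using that N by (auto simp: nb_def)
      have M2A1: "ev M2 x \<subseteq> ev A1 x" by (rule ev_below[OF M2 x])
      \<comment> \<open>Rejection propagates along the elements of \<open>N\<close>.
        \<open>h0\<close> handles the first one after the stem; from the preceding element
        \<open>p\<close> it passes to \<open>n\<close> because a rejected stem leaves only the
        second alternative of \<open>Q\<close>.\<close>
      have gd: "n \<in> N \<Longrightarrow> m0 \<le> n \<Longrightarrow> good n (N \<inter> {..n}) x" for n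
      proof (induction n rule: less_induct)
        case (less n)
        show ?case
        proof (cases "N \<inter> {m0..<n} = {}")
          case True
          have "n \<in> ev A1 x" using inM2[OF less.prems] M2A1 by blast
          then have "good n (insert n e0) x" using a1 less.prems(2) by simp
          then show ?thesis using nb_least[OF N less.prems True] by simp
        next
          case False
          define p where "p = Max (N \<inter> {m0..<n})"
          have "p \<in> N \<inter> {m0..<n}" unfolding p_def using False by (intro Max_in) auto
          then have p: "p \<in> N" "m0 \<le> p" "p < n" by auto
          have "q \<le> p" if "q \<in> N" "m0 \<le> q" "q < n" for q
            unfolding p_def using that by (intro Max_ge) auto
          then have Nn: "N \<inter> {..n} = insert n (N \<inter> {..p})" using p less.prems by force
          let ?e = "N \<inter> {..p}"
          obtain k where k: "bad (Suc p) ?e (ini x k) (trim (Suc p) M1)"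
            using less.IH[OF p(3,1,2)] unfolding good_def by blast
          have "\<exists>k. \<forall>l\<ge>k. Q (Suc p) ?e (ini x l) (trim (Suc p) M2)"
            using a2[rule_format, OF inM2[OF p(1,2)], of 0 ?e] by simp
          then obtain k' where k': "\<forall>l\<ge>k'. Q (Suc p) ?e (ini x l) (trim (Suc p) M2)" by blast
          let ?l = "k + k' + length (s @ w)"
          have "\<not> acc (Suc p) ?e (ini x ?l) (trim (Suc p) M2)"
          proof (rule blockedD[OF k[unfolded bad_def]])
            show "name (ini x ?l) (trim (Suc p) M2)" by (rule name_ini[OF name_trim[OF M2(1)] x]) simp
            show "below (ini x ?l) (trim (Suc p) M2) (trim (Suc p) M1)"
              by (rule below_ini[OF below_trim_mono[OF M21] x]) simp
          qed simp
          moreover have "Q (Suc p) ?e (ini x ?l) (trim (Suc p) M2)" using k' by simp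
          ultimately have "forces (ini x ?l) (\<lambda>x. \<forall>n\<in>ev (trim (Suc p) M2) x. Suc p \<le> n \<longrightarrow> good n (insert n ?e) x)"
            unfolding Q_def by blast
          moreover have "finite ?e" by simp
          ultimately have "\<forall>n\<in>ev (trim (Suc p) M2) x. Suc p \<le> n \<longrightarrow> good n (insert n ?e) x"
            using a3[rule_format (no_asm), of ?e "?l" p] by meson
          moreover have "n \<in> ev (trim (Suc p) M2) x" using inM2[OF less.prems] p(3) by (simp add: ev_trim)
          ultimately show ?thesis using p(3) Nn by simp
        qed
      qed
      show "N \<in> - G x"
      proof
        assume NG: "N \<in> G x"
        have "infinite N" using N by (simp add: nb_def)
        then have "\<exists>k m. \<forall>x'\<in>cyl (ini x k). \<forall>N'. infinite N' \<longrightarrow>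
            N' \<inter> {..<m} = N \<inter> {..<m} \<longrightarrow> N' \<in> G x'" by (rule G[unfolded open_rel_def, rule_format, OF NG])
        then obtain k m where km: "\<And>x' N'. x' \<in> cyl (ini x k) \<Longrightarrow> infinite N' \<Longrightarrow>
            N' \<inter> {..<m} = N \<inter> {..<m} \<Longrightarrow> N' \<in> G x'" by meson
        \<comment> \<open>With \<open>n\<close> beyond \<open>m\<close>, agreement up to
          \<open>n\<close> implies the agreement below \<open>m\<close> that puts a set into
          \<open>G\<close>. The stem \<open>N \<inter> {..n}\<close> is therefore accepted outright,
          although it was rejected.\<close>
        obtain n where n: "n \<in> N" "m + m0 \<le> n" using nb_unbounded[OF N] by blast
        obtain k' where k': "bad (Suc n) (N \<inter> {..n}) (ini x k') (trim (Suc n) M1)"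
          using gd[OF n(1)] n(2) unfolding good_def by auto
        let ?l = "k + k' + length (s @ w)"
        have "\<not> acc (Suc n) (N \<inter> {..n}) (ini x ?l) (trim (Suc n) M1)"
        proof (rule blockedD[OF k'[unfolded bad_def]])
          show "name (ini x ?l) (trim (Suc n) M1)"
            by (rule name_ini[OF name_trim[OF name_append[OF M1(1)]] x]) simp
        qed simp_all
        moreover have "acc (Suc n) (N \<inter> {..n}) (ini x ?l) (trim (Suc n) M1)"
          unfolding acc_def inside_def
        proof (rule forces_trivial, rule subsetI)
          fix x' N' assume x': "x' \<in> cyl (ini x ?l)"
            and N': "N' \<in> nb (Suc n) (N \<inter> {..n}) (ev (trim (Suc n) M1) x')"
          have "ini x' k = ini x k" using cyl_ini_le[OF x', of k] by simp
          then have "x' \<in> cyl (ini x k)" by (metis ini_in_cyl)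
          moreover have "N' \<inter> {..<m} = N \<inter> {..<m}"
          proof -
            have "N' \<inter> {..n} = N \<inter> {..n}" using N' by (auto simp: nb_def lessThan_Suc_atMost)
            moreover have "{..<m} \<subseteq> {..n}" using n(2) by auto
            ultimately show ?thesis by blast
          qed
          moreover have "infinite N'" using N' by (simp add: nb_def)
          ultimately show "N' \<in> G x'" using km by blast
        qed
        ultimately show False by blast
      qed
    qed
    then have "inside m0 e0 (\<lambda>x. - G x) (s @ w) M2" by (simp add: inside_def)
    then show ?thesis using M2(1) below_trans[OF M2(2) A1A] by blast
  qed
qed

section \<open>Closure under complement, countable unions and the Souslin operation\<close>

lemma UR_compl: "UR Y \<Longrightarrow> UR (\<lambda>x. - Y x)"
  unfolding UR_def by (simp add: disj_commute)

lemma UR_cong: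
  assumes "UR Y" and "\<And>x N. infinite N \<Longrightarrow> N \<in> Y' x \<longleftrightarrow> N \<in> Y x"
  shows "UR Y'"
proof -
  have "nb m e L \<subseteq> Y' x \<longleftrightarrow> nb m e L \<subseteq> Y x" "nb m e L \<subseteq> - Y' x \<longleftrightarrow> nb m e L \<subseteq> - Y x" for m e L x
    using assms(2) by (auto simp: nb_def)
  then show ?thesis using assms(1) unfolding UR_def inside_def by simp
qed

lemma inside_mono:
  assumes "inside m e Y r M" and "forces r (\<lambda>x. nb m e (ev M x) \<inter> Y x \<subseteq> Z x)"
  shows "inside m e Z r M"
  using forces_conj[OF assms(1)[unfolded inside_def] assms(2)] unfolding inside_def
  by (rule forces_mono) blast

text \<open>It suffices to know a relation on one neighbourhood at generic points. After a fusion
  this lets a complicated relation be replaced there by an open or closed one.\<close>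

lemma UR_transfer:
  assumes Z: "UR Z" and e: "e \<subseteq> {..<m}" and M: "name s M"
    and eq: "forces s (\<lambda>x. \<forall>N\<in>nb m e (ev M x). N \<in> Y x \<longleftrightarrow> N \<in> Z x)"
  shows "\<exists>u M'. name (s @ u) M' \<and> below (s @ u) M' M \<and>
     (inside m e Y (s @ u) M' \<or> inside m e (\<lambda>x. - Y x) (s @ u) M')"
proof -
  obtain u M' where M': "name (s @ u) M'" "below (s @ u) M' M"
    and d: "inside m e Z (s @ u) M' \<or> inside m e (\<lambda>x. - Z x) (s @ u) M'"
    using Z e M unfolding UR_def by blast
  have f: "forces (s @ u) (\<lambda>x. \<forall>N\<in>nb m e (ev M' x). N \<in> Y x \<longleftrightarrow> N \<in> Z x)"
    using forces_append[OF eq, of u]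
  proof (rule forces_mono)
    fix x assume x: "x \<in> cyl (s @ u)" and *: "\<forall>N\<in>nb m e (ev M x). N \<in> Y x \<longleftrightarrow> N \<in> Z x"
    show "\<forall>N\<in>nb m e (ev M' x). N \<in> Y x \<longleftrightarrow> N \<in> Z x"
      using * nb_mono[OF ev_below[OF M' x], of m e] by blast
  qed
  have "inside m e Y (s @ u) M' \<or> inside m e (\<lambda>x. - Y x) (s @ u) M'"
    using d
  proof
    assume "inside m e Z (s @ u) M'"
    then have "inside m e Y (s @ u) M'" by (rule inside_mono) (rule forces_mono[OF f], blast)
    then show ?thesis ..
  next
    assume "inside m e (\<lambda>x. - Z x) (s @ u) M'"
    then have "inside m e (\<lambda>x. - Y x) (s @ u) M'" by (rule inside_mono) (rule forces_mono[OF f], blast)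
    then show ?thesis ..
  qed
  then show ?thesis using M' by blast
qed

lemma URD:
  assumes "UR Y" "e \<subseteq> {..<m}" "name (s @ u) A"
  shows "\<exists>w M. name (s @ u @ w) M \<and> below (s @ u @ w) M A \<and>
     (inside m e Y (s @ u @ w) M \<or> inside m e (\<lambda>x. - Y x) (s @ u @ w) M)"
  using assms unfolding UR_def by (metis append.assoc)

text \<open>After fusion every stem up to some \<open>n \<ge> i\<close> in the name decides
  \<open>Y i\<close>. On the neighbourhood, membership in the union is then witnessed by a stem with
  a positive decision, so the union coincides with the open relation \<open>G\<close>.\<close>

lemma UR_UN:
  fixes Y :: "nat \<Rightarrow> (nat \<Rightarrow> nat) \<Rightarrow> nat set set"
  assumes Y: "\<And>i. UR (Y i)"
  shows "UR (\<lambda>x. \<Union>i. Y i x)"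
  unfolding UR_def
proof (intro allI impI)
  fix m :: nat and e :: "nat set" and s A
  assume e: "e \<subseteq> {..<m}" and A: "name s A"
  obtain M where M: "name s M" "below s M A"
    and g: "forces s (\<lambda>x. \<forall>i n e. n \<in> ev M x \<longrightarrow> i \<le> n \<longrightarrow> e \<subseteq> {..n} \<longrightarrow>
       (\<exists>k. \<forall>l\<ge>k. inside (Suc n) e (Y i) (ini x l) (trim (Suc n) M)
          \<or> inside (Suc n) e (\<lambda>x. - Y i x) (ini x l) (trim (Suc n) M)))"
  proof (rule generic_fusion[OF A, of "\<lambda>i m e r M. inside m e (Y i) r M \<or> inside m e (\<lambda>x. - Y i x) r M"])
    show "hered (\<lambda>r M. inside m e (Y i) r M \<or> inside m e (\<lambda>x. - Y i x) r M)" for i m e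
      by (intro hered_disj hered_inside)
  qed (use URD[OF Y] in blast)+
  define G where "G x = {N. \<exists>i n k. n \<in> N \<and> m \<le> n \<and> inside (Suc n) (N \<inter> {..n}) (Y i) (ini x k) (trim (Suc n) M)}" for x
  have "open_rel G" unfolding open_rel_def
  proof (intro allI ballI impI)
    fix x N assume "N \<in> G x"
    then obtain i n k where n: "n \<in> N" "m \<le> n" "inside (Suc n) (N \<inter> {..n}) (Y i) (ini x k) (trim (Suc n) M)"
      unfolding G_def by blast
    have "N' \<in> G x'" if x': "x' \<in> cyl (ini x k)" and N': "N' \<inter> {..<Suc n} = N \<inter> {..<Suc n}" for x' N'
    proof -
      have "ini x' k = ini x k" using cyl_ini_le[OF x', of k] by simp
      moreover have "N' \<inter> {..n} = N \<inter> {..n}" using N' by (simp add: lessThan_Suc_atMost)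
      moreover from this have "n \<in> N'" using n(1) by auto
      ultimately show ?thesis unfolding G_def using n(2,3) by (intro CollectI exI[of _ i] exI[of _ n] exI[of _ k]) simp
    qed
    then show "\<exists>k m. \<forall>x'\<in>cyl (ini x k). \<forall>N'. infinite N' \<longrightarrow> N' \<inter> {..<m} = N \<inter> {..<m} \<longrightarrow> N' \<in> G x'"
      by (intro exI[of _ k] exI[of _ "Suc n"]) simp
  qed
  then have UG: "UR G" by (rule UR_open)
  \<comment> \<open>The Boolean component codes the two possible decisions, so that one application
    of \<open>forces_self_finite_sets\<close> covers both of them for all stems.\<close>
  define \<phi> where "\<phi> p e x \<longleftrightarrow> nb (Suc (fst p)) e (ev (trim (Suc (fst p)) M) x) \<subseteq>
     (if snd (snd p) then Y (fst (snd p)) x else - Y (fst (snd p)) x)" for p :: "nat \<times> nat \<times> bool" and e x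
  have "forces s (\<lambda>x. \<forall>p e k. finite e \<longrightarrow> forces (ini x k) (\<phi> p e) \<longrightarrow> \<phi> p e x)"
    by (rule forces_self_finite_sets)
  from forces_conj[OF g this]
  have "forces s (\<lambda>x. \<forall>N\<in>nb m e (ev M x). N \<in> (\<Union>i. Y i x) \<longleftrightarrow> N \<in> G x)"
  proof (rule forces_mono, intro ballI)
    fix x N
    assume x: "x \<in> cyl s"
      and all: "(\<forall>i n e. n \<in> ev M x \<longrightarrow> i \<le> n \<longrightarrow> e \<subseteq> {..n} \<longrightarrow>
       (\<exists>k. \<forall>l\<ge>k. inside (Suc n) e (Y i) (ini x l) (trim (Suc n) M)
          \<or> inside (Suc n) e (\<lambda>x. - Y i x) (ini x l) (trim (Suc n) M))) \<and>
       (\<forall>p e k. finite e \<longrightarrow> forces (ini x k) (\<phi> p e) \<longrightarrow> \<phi> p e x)"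
      and N: "N \<in> nb m e (ev M x)"
    note a1 = conjunct1[OF all] and a2 = conjunct2[OF all]
    have nx: "N \<in> nb (Suc n) (N \<inter> {..n}) (ev (trim (Suc n) M) x)" if "m \<le> n" for n
      using nb_next[OF N that] by (simp add: ev_trim)
    have inY: "N \<in> Y i x" if "m \<le> n" "inside (Suc n) (N \<inter> {..n}) (Y i) (ini x k) (trim (Suc n) M)" for n i k
    proof -
      have "forces (ini x k) (\<phi> (n, i, True) (N \<inter> {..n}))" using that(2) by (simp add: inside_def \<phi>_def[abs_def])
      then have "\<phi> (n, i, True) (N \<inter> {..n}) x" using a2[rule_format, of "N \<inter> {..n}"] by simp
      then show ?thesis using nx[OF that(1)] by (auto simp: \<phi>_def)
    qed
    have notY: "N \<notin> Y i x" if "m \<le> n" "inside (Suc n) (N \<inter> {..n}) (\<lambda>x. - Y i x) (ini x k) (trim (Suc n) M)" for n i k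
    proof -
      have "forces (ini x k) (\<phi> (n, i, False) (N \<inter> {..n}))" using that(2) by (simp add: inside_def \<phi>_def[abs_def])
      then have "\<phi> (n, i, False) (N \<inter> {..n}) x" using a2[rule_format, of "N \<inter> {..n}"] by simp
      then show ?thesis using nx[OF that(1)] by (auto simp: \<phi>_def)
    qed
    show "N \<in> (\<Union>i. Y i x) \<longleftrightarrow> N \<in> G x"
    proof
      assume "N \<in> (\<Union>i. Y i x)"
      then obtain i where i: "N \<in> Y i x" by blast
      \<comment> \<open>\<open>n\<close> is taken above \<open>i\<close> as well, since fusion
        decides \<open>Y i\<close> only for stems up to elements that are at least
        \<open>i\<close>.\<close>
      obtain n where n: "n \<in> N" "m + i \<le> n" using nb_unbounded[OF N] by blast
      have "n \<in> ev M x" using N n by (auto simp: nb_def)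
      from a1[rule_format, OF this, of i "N \<inter> {..n}"] n(2) obtain k where
        "inside (Suc n) (N \<inter> {..n}) (Y i) (ini x k) (trim (Suc n) M)
          \<or> inside (Suc n) (N \<inter> {..n}) (\<lambda>x. - Y i x) (ini x k) (trim (Suc n) M)" by auto
      then have "inside (Suc n) (N \<inter> {..n}) (Y i) (ini x k) (trim (Suc n) M)"
        using notY[of n i k] n(2) i by auto
      then show "N \<in> G x" unfolding G_def using n by (intro CollectI exI[of _ i] exI[of _ n] exI[of _ k]) simp
    next
      assume "N \<in> G x"
      then show "N \<in> (\<Union>i. Y i x)" unfolding G_def using inY by blast
    qed
  qed
  from UR_transfer[OF UG e M(1) this] obtain u M' where M': "name (s @ u) M'" "below (s @ u) M' M"
    "inside m e (\<lambda>x. \<Union>i. Y i x) (s @ u) M' \<or> inside m e (\<lambda>x. - (\<Union>i. Y i x)) (s @ u) M'" by blast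
  moreover have "below (s @ u) M' A" using below_trans[OF M'(2) below_append[OF M(2)]] .
  ultimately show "\<exists>u M. name (s @ u) M \<and> below (s @ u) M A \<and>
     (inside m e (\<lambda>x. \<Union>i. Y i x) (s @ u) M \<or> inside m e (\<lambda>x. - (\<Union>i. Y i x)) (s @ u) M)" by blast
qed

lemma UR_Un:
  assumes "UR Y" "UR Z"
  shows "UR (\<lambda>x. Y x \<union> Z x)"
proof -
  have "UR (\<lambda>x. \<Union>i::nat. (if i = 0 then Y else Z) x)" using assms by (intro UR_UN) simp
  then show ?thesis by (rule UR_cong) (auto split: if_splits)
qed

lemma UR_Int: "UR Y \<Longrightarrow> UR Z \<Longrightarrow> UR (\<lambda>x. Y x \<inter> Z x)"
  using UR_compl[OF UR_Un[OF UR_compl UR_compl], of Y Z] by simp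

lemma UR_INT:
  fixes Y :: "nat \<Rightarrow> (nat \<Rightarrow> nat) \<Rightarrow> nat set set"
  assumes "\<And>i. UR (Y i)"
  shows "UR (\<lambda>x. \<Inter>i. Y i x)"
  using UR_compl[OF UR_UN[OF UR_compl[OF assms]]] by simp

lemma UR_empty: "UR (\<lambda>x. {})"
  by (rule UR_open) (simp add: open_rel_def)

text \<open>The hull argument of Szpilrajn-Marczewski. \<open>Y \<tau>\<close> is the part of the
  Souslin set obtained from branches through \<open>\<tau>\<close>, and \<open>R \<tau>\<close> is
  the open relation of having a stem that rejects it. A second fusion avoids all exceptional sets
  \<open>Z \<tau>\<close>; a set outside \<open>R []\<close> can then be followed to a full branch,
  so on the neighbourhood the Souslin set is the closed relation \<open>- R []\<close>.\<close>

lemma UR_Souslin: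
  assumes C: "\<And>t. UR (C t)"
  shows "UR (\<lambda>x. {N. \<exists>\<sigma>. \<forall>n. N \<in> C (ini \<sigma> (Suc n)) x})"
  unfolding UR_def
proof (intro allI impI)
  fix m :: nat and e :: "nat set" and s A
  assume e: "e \<subseteq> {..<m}" and A: "name s A"
  define Y where "Y \<tau> x = {N. \<exists>\<sigma>\<in>cyl \<tau>. \<forall>n. N \<in> C (ini \<sigma> (Suc n)) x}" for \<tau> x
  define rej where "rej \<tau> m e = inside m e (\<lambda>x. - Y \<tau> x)" for \<tau> m e
  \<comment> \<open>The index \<open>i\<close> codes a finite sequence, so for each
    \<open>\<tau>\<close> rejection of \<open>Y \<tau>\<close> is settled, positively or for good
    negatively, by stems up to elements that are at least \<open>to_nat \<tau>\<close>.\<close>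
  obtain M1 where M1: "name s M1" "below s M1 A"
    and g1: "forces s (\<lambda>x. \<forall>i n e. n \<in> ev M1 x \<longrightarrow> i \<le> n \<longrightarrow> e \<subseteq> {..n} \<longrightarrow>
       (\<exists>k. \<forall>l\<ge>k. rej (from_nat i) (Suc n) e (ini x l) (trim (Suc n) M1)
          \<or> blocked (rej (from_nat i) (Suc n) e) (ini x l) (trim (Suc n) M1)))"
  proof (rule generic_fusion[OF A, of "\<lambda>i m e r M. rej (from_nat i) m e r M \<or> blocked (rej (from_nat i) m e) r M"])
    show "hered (\<lambda>r M. rej (from_nat i) m e r M \<or> blocked (rej (from_nat i) m e) r M)" for i m e
      unfolding rej_def by (intro hered_disj hered_inside hered_blocked)
    show "\<exists>w M. name (s @ u @ w) M \<and> below (s @ u @ w) M A' \<and>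
      (rej (from_nat i) m e (s @ u @ w) M \<or> blocked (rej (from_nat i) m e) (s @ u @ w) M)"
      if "name (s @ u) A'" for i m e u A'
      using decided_dense[OF that, of "rej (from_nat i) m e"] by simp
  qed blast
  \<comment> \<open>Relative to \<open>M1\<close>, the closed relation \<open>- R \<tau>\<close> is a measurable hull of \<open>Y \<tau>\<close>, so the sets
    \<open>Z \<tau>\<close> where the hulls fail to behave like a Souslin scheme are null and can be avoided by fusion.\<close>
  define R where "R \<tau> x = {N. \<exists>n k. n \<in> N \<and> m \<le> n \<and> to_nat \<tau> \<le> n \<and>
      rej \<tau> (Suc n) (N \<inter> {..n}) (ini x k) (trim (Suc n) M1)}" for \<tau> x
  have "open_rel (R \<tau>)" for \<tau> unfolding open_rel_def
  proof (intro allI ballI impI)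
    fix x N assume "N \<in> R \<tau> x"
    then obtain n k where n: "n \<in> N" "m \<le> n" "to_nat \<tau> \<le> n" "rej \<tau> (Suc n) (N \<inter> {..n}) (ini x k) (trim (Suc n) M1)"
      unfolding R_def by blast
    have "N' \<in> R \<tau> x'" if x': "x' \<in> cyl (ini x k)" and N': "N' \<inter> {..<Suc n} = N \<inter> {..<Suc n}" for x' N'
    proof -
      have "ini x' k = ini x k" using cyl_ini_le[OF x', of k] by simp
      moreover have "N' \<inter> {..n} = N \<inter> {..n}" using N' by (simp add: lessThan_Suc_atMost)
      moreover from this have "n \<in> N'" using n(1) by auto
      ultimately show ?thesis unfolding R_def using n(2-4) by (intro CollectI exI[of _ n] exI[of _ k]) simp
    qed
    then show "\<exists>k m. \<forall>x'\<in>cyl (ini x k). \<forall>N'. infinite N' \<longrightarrow> N' \<inter> {..<m} = N \<inter> {..<m} \<longrightarrow> N' \<in> R \<tau> x'"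
      by (intro exI[of _ k] exI[of _ "Suc n"]) simp
  qed
  then have UR_R: "UR (R \<tau>)" for \<tau> by (rule UR_open)
  \<comment> \<open>\<open>E \<tau>\<close> is the complement of
    \<open>C \<tau> \<inter> (\<Union>c. - R (\<tau> @ [c]))\<close>. The Souslin scheme starts with
    sequences of length one, so at the empty sequence \<open>C\<close> imposes nothing.\<close>
  define E where "E \<tau> x = (if \<tau> = [] then {} else - C \<tau> x) \<union> (\<Inter>c. R (\<tau> @ [c]) x)" for \<tau> x
  have UR_E: "UR (E \<tau>)" for \<tau>
  proof -
    have "UR (\<lambda>x. if \<tau> = [] then {} else - C \<tau> x)" using UR_empty UR_compl[OF C, of \<tau>] by (cases "\<tau> = []") simp_all
    then show ?thesis unfolding E_def[abs_def] by (intro UR_Un UR_INT UR_R)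
  qed
  have RY: "forces s (\<lambda>x. \<forall>\<tau> N. infinite N \<longrightarrow> N \<inter> {m..} \<subseteq> ev M1 x \<longrightarrow> N \<in> R \<tau> x \<longrightarrow> N \<notin> Y \<tau> x)"
  proof -
    define \<phi> where "\<phi> p e x \<longleftrightarrow> nb (Suc (fst p)) e (ev (trim (Suc (fst p)) M1) x) \<subseteq> - Y (snd p) x"
      for p :: "nat \<times> nat list" and e x
    have "forces s (\<lambda>x. \<forall>p e k. finite e \<longrightarrow> forces (ini x k) (\<phi> p e) \<longrightarrow> \<phi> p e x)"
      by (rule forces_self_finite_sets)
    then show ?thesis
    proof (rule forces_mono, intro allI impI)
      fix x \<tau> N
      assume self: "\<forall>p e k. finite e \<longrightarrow> forces (ini x k) (\<phi> p e) \<longrightarrow> \<phi> p e x"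
        and N: "infinite N" "N \<inter> {m..} \<subseteq> ev M1 x" "N \<in> R \<tau> x"
      obtain n k where n: "m \<le> n" "rej \<tau> (Suc n) (N \<inter> {..n}) (ini x k) (trim (Suc n) M1)"
        using N(3) unfolding R_def by blast
      have "forces (ini x k) (\<phi> (n, \<tau>) (N \<inter> {..n}))" using n(2) by (simp add: rej_def inside_def \<phi>_def[abs_def])
      then have "\<phi> (n, \<tau>) (N \<inter> {..n}) x" using self[rule_format, of "N \<inter> {..n}"] by simp
      moreover have "N \<in> nb (Suc n) (N \<inter> {..n}) (ev (trim (Suc n) M1) x)"
        using N(1,2) n(1) by (auto simp: nb_def ev_trim)
      ultimately show "N \<notin> Y \<tau> x" by (auto simp: \<phi>_def)
    qed
  qed
  \<comment> \<open>A branch through \<open>\<tau>\<close> witnesses membership in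
    \<open>C \<tau>\<close> and continues through some \<open>\<tau> @ [c]\<close>, so the set also
    belongs to \<open>Y (\<tau> @ [c])\<close>, which \<open>R (\<tau> @ [c])\<close>
    misses.\<close>
  have EY: "forces s (\<lambda>x. \<forall>\<tau> N. infinite N \<longrightarrow> N \<inter> {m..} \<subseteq> ev M1 x \<longrightarrow> N \<in> E \<tau> x \<longrightarrow> N \<notin> Y \<tau> x)"
    using RY
  proof (rule forces_mono, intro allI impI notI)
    fix x \<tau> N
    assume ry: "\<forall>\<tau> N. infinite N \<longrightarrow> N \<inter> {m..} \<subseteq> ev M1 x \<longrightarrow> N \<in> R \<tau> x \<longrightarrow> N \<notin> Y \<tau> x"
      and N: "infinite N" "N \<inter> {m..} \<subseteq> ev M1 x" "N \<in> E \<tau> x" "N \<in> Y \<tau> x"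
    obtain \<sigma> where \<sigma>: "\<sigma> \<in> cyl \<tau>" "\<forall>n. N \<in> C (ini \<sigma> (Suc n)) x" using N(4) unfolding Y_def by blast
    have "N \<in> C \<tau> x" if "\<tau> \<noteq> []"
    proof -
      have "Suc (length \<tau> - 1) = length \<tau>" using that by simp
      then show ?thesis using \<sigma>(2)[rule_format, of "length \<tau> - 1"] \<sigma>(1) by (simp add: cyl_def)
    qed
    then have "N \<in> R (\<tau> @ [\<sigma> (length \<tau>)]) x" using N(3) unfolding E_def by (auto split: if_splits)
    moreover have "\<sigma> \<in> cyl (\<tau> @ [\<sigma> (length \<tau>)])" using \<sigma>(1) by (simp add: cyl_def ini_Suc)
    then have "N \<in> Y (\<tau> @ [\<sigma> (length \<tau>)]) x" unfolding Y_def using \<sigma>(2) by blast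
    ultimately show False using ry N(1,2) by blast
  qed
  define Z where "Z \<tau> x = {N \<in> E \<tau> x. N \<notin> R \<tau> x \<and> N \<inter> {m..} \<subseteq> ev M1 x}" for \<tau> x
  \<comment> \<open>A neighbourhood inside \<open>E \<tau>\<close> misses \<open>Y \<tau>\<close> as
    far as it lies in \<open>M1\<close>. If it contained some \<open>N\<close> in
    \<open>Z \<tau>\<close>, then rejection would be blocked at a long stem of \<open>N\<close>,
    because \<open>N\<close> is not in \<open>R \<tau>\<close>. Yet all sets with that stem and tail
    in \<open>M\<close> belong to the same neighbourhood, so the stem is rejected, a
    contradiction.\<close>
  have null: "\<exists>w M. name (s @ u @ w) M \<and> below (s @ u @ w) M A' \<and> inside m' e' (\<lambda>x. - Z \<tau> x) (s @ u @ w) M"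
    if e': "e' \<subseteq> {..<m'}" and A': "name (s @ u) A'" "below (s @ u) A' M1" for \<tau> m' e' u A'
  proof -
    obtain w M where M: "name (s @ u @ w) M" "below (s @ u @ w) M A'"
      and d: "inside m' e' (E \<tau>) (s @ u @ w) M \<or> inside m' e' (\<lambda>x. - E \<tau> x) (s @ u @ w) M"
      using URD[OF UR_E e' A'(1)] by blast
    have MM1: "below (s @ u @ w) M M1" using below_trans[OF M(2)] below_append[OF A'(2), of w] by simp
    have "inside m' e' (\<lambda>x. - Z \<tau> x) (s @ u @ w) M"
      using d
    proof
      assume "inside m' e' (\<lambda>x. - E \<tau> x) (s @ u @ w) M"
      then show ?thesis by (rule inside_mono) (rule forces_trivial, auto simp: Z_def)
    next
      assume inE: "inside m' e' (E \<tau>) (s @ u @ w) M"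
      show ?thesis unfolding inside_def using forces_append[OF g1, of "u @ w"]
      proof (rule forces_mono, intro subsetI ComplI)
        fix x N
        assume x: "x \<in> cyl (s @ u @ w)"
          and gx: "\<forall>i n e. n \<in> ev M1 x \<longrightarrow> i \<le> n \<longrightarrow> e \<subseteq> {..n} \<longrightarrow>
           (\<exists>k. \<forall>l\<ge>k. rej (from_nat i) (Suc n) e (ini x l) (trim (Suc n) M1)
          \<or> blocked (rej (from_nat i) (Suc n) e) (ini x l) (trim (Suc n) M1))"
          and N: "N \<in> nb m' e' (ev M x)" and NZ: "N \<in> Z \<tau> x"
        obtain n where n: "n \<in> N" "m + m' + to_nat \<tau> \<le> n" using nb_unbounded[OF N] by blast
        have "n \<in> ev M x" using N n by (auto simp: nb_def)
        then have "n \<in> ev M1 x" using ev_below[OF M(1) MM1 x] by blast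
        from gx[rule_format, OF this, of "to_nat \<tau>" "N \<inter> {..n}"] n(2) obtain k where
          "rej \<tau> (Suc n) (N \<inter> {..n}) (ini x k) (trim (Suc n) M1)
          \<or> blocked (rej \<tau> (Suc n) (N \<inter> {..n})) (ini x k) (trim (Suc n) M1)" by auto
        moreover have "\<not> rej \<tau> (Suc n) (N \<inter> {..n}) (ini x k) (trim (Suc n) M1)"
        proof
          assume "rej \<tau> (Suc n) (N \<inter> {..n}) (ini x k) (trim (Suc n) M1)"
          then have "N \<in> R \<tau> x" unfolding R_def using n by (intro CollectI exI[of _ n] exI[of _ k]) simp
          then show False using NZ by (simp add: Z_def)
        qed
        ultimately have bl: "blocked (rej \<tau> (Suc n) (N \<inter> {..n})) (ini x k) (trim (Suc n) M1)" by blast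
        have s1: "N \<inter> {m'..n} \<subseteq> ev M x" and s2: "N \<inter> {m..n} \<subseteq> ev M1 x"
          using N NZ by (auto simp: nb_def Z_def)
        obtain k1 where k1: "\<forall>l\<ge>k1. N \<inter> {m'..n} \<subseteq> M (ini x l)"
          using finite_subset_ev[OF M(1) _ s1] by auto
        obtain k2 where k2: "\<forall>l\<ge>k2. N \<inter> {m..n} \<subseteq> M1 (ini x l)"
          using finite_subset_ev[OF M1(1) _ s2] by auto
        \<comment> \<open>Long enough that the elements of the stem from \<open>m'\<close> on are
          already in \<open>M\<close>, and those from \<open>m\<close> on in \<open>M1\<close>;
          every point through this node then has them in its values.\<close>
        define l where "l = k + k1 + k2 + length (s @ u @ w)"
        obtain z where z: "ini x l = (s @ u @ w) @ z" using cyl_ini_ge[OF x, of l] by (auto simp: l_def)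
        have N1: "N \<inter> {m'..n} \<subseteq> M (ini x l)" and N2: "N \<inter> {m..n} \<subseteq> M1 (ini x l)"
          using k1 k2 by (simp_all add: l_def)
        have "\<not> rej \<tau> (Suc n) (N \<inter> {..n}) (ini x l) (trim (Suc n) M)"
        proof (rule blockedD[OF bl])
          show "k \<le> l" by (simp add: l_def)
          show "name (ini x l) (trim (Suc n) M)" by (rule name_ini[OF name_trim[OF M(1)] x]) (simp add: l_def)
          show "below (ini x l) (trim (Suc n) M) (trim (Suc n) M1)"
            by (rule below_ini[OF below_trim_mono[OF MM1] x]) (simp add: l_def)
        qed
        moreover have "rej \<tau> (Suc n) (N \<inter> {..n}) (ini x l) (trim (Suc n) M)"
        proof -
          have fE: "forces (ini x l) (\<lambda>x. nb m' e' (ev M x) \<subseteq> E \<tau> x)"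
            unfolding z by (rule forces_append[OF inE[unfolded inside_def]])
          have fEY: "forces (ini x l) (\<lambda>x. \<forall>\<tau> N. infinite N \<longrightarrow> N \<inter> {m..} \<subseteq> ev M1 x \<longrightarrow> N \<in> E \<tau> x \<longrightarrow> N \<notin> Y \<tau> x)"
            using forces_append[OF EY, of "u @ w @ z"] z by simp
          show ?thesis unfolding rej_def inside_def using forces_conj[OF fE fEY]
          proof (rule forces_mono, intro subsetI ComplI)
            fix x' N'
            assume x': "x' \<in> cyl (ini x l)"
              and a: "nb m' e' (ev M x') \<subseteq> E \<tau> x' \<and> (\<forall>\<tau> N. infinite N \<longrightarrow> N \<inter> {m..} \<subseteq> ev M1 x' \<longrightarrow> N \<in> E \<tau> x' \<longrightarrow> N \<notin> Y \<tau> x')"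
              and N': "N' \<in> nb (Suc n) (N \<inter> {..n}) (ev (trim (Suc n) M) x')" and NY: "N' \<in> Y \<tau> x'"
            have inf: "infinite N'" and seg: "N' \<inter> {..n} = N \<inter> {..n}" and tl: "N' \<inter> {Suc n..} \<subseteq> ev M x'"
              using N' by (auto simp: nb_def ev_trim lessThan_Suc_atMost)
            have il: "ini x' l = ini x l" using cyl_ini_le[OF x', of l] by simp
            have "x' \<in> cyl (s @ u @ w)" using x' cyl_append[of x' "s @ u @ w" z] z by simp
            then have evs: "ev M x' \<subseteq> ev M1 x'" by (rule ev_below[OF M(1) MM1])
            have split: "N' \<inter> {j..} \<subseteq> (N \<inter> {j..n}) \<union> (N' \<inter> {Suc n..})" for j
            proof
              fix q assume q: "q \<in> N' \<inter> {j..}"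
              show "q \<in> (N \<inter> {j..n}) \<union> (N' \<inter> {Suc n..})"
              proof (cases "q \<le> n")
                case True
                then have "q \<in> N \<inter> {..n}" using q seg[symmetric] by simp
                then show ?thesis using q by simp
              qed (use q in simp)
            qed
            have "N \<inter> {m'..n} \<subseteq> ev M x'" using N1 unfolding il[symmetric] ev_def by blast
            then have t1: "N' \<inter> {m'..} \<subseteq> ev M x'" using split[of m'] tl by blast
            have "N \<inter> {m..n} \<subseteq> ev M1 x'" using N2 unfolding il[symmetric] ev_def by blast
            then have t2: "N' \<inter> {m..} \<subseteq> ev M1 x'" using split[of m] tl evs by blast
            have "{..<m'} \<subseteq> {..n}" using n(2) by auto
            then have "N' \<inter> {..<m'} = N \<inter> {..<m'}" using seg by blast
            then have "N' \<in> nb m' e' (ev M x')" using inf t1 N by (simp add: nb_def)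
            then have "N' \<in> E \<tau> x'" using a by blast
            then show False using conjunct2[OF a] inf t2 NY by blast
          qed
        qed
        ultimately show False by blast
      qed
    qed
    then show ?thesis using M by blast
  qed
  obtain M2 where M2: "name s M2" "below s M2 M1"
    and g2: "forces s (\<lambda>x. \<forall>i n e. n \<in> ev M2 x \<longrightarrow> i \<le> n \<longrightarrow> e \<subseteq> {..n} \<longrightarrow>
       (\<exists>k. \<forall>l\<ge>k. inside (Suc n) e (\<lambda>x. - Z (from_nat i) x) (ini x l) (trim (Suc n) M2)))"
  proof (rule generic_fusion[OF M1(1), of "\<lambda>i m e. inside m e (\<lambda>x. - Z (from_nat i) x)"])
    show "hered (inside m e (\<lambda>x. - Z (from_nat i) x))" for i m e by (rule hered_inside)
  qed (use null in blast)+
  define \<psi> where "\<psi> p e x \<longleftrightarrow> nb (Suc (fst p)) e (ev (trim (Suc (fst p)) M2) x) \<subseteq> - Z (snd p) x"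
    for p :: "nat \<times> nat list" and e x
  have "forces s (\<lambda>x. \<forall>p e k. finite e \<longrightarrow> forces (ini x k) (\<psi> p e) \<longrightarrow> \<psi> p e x)"
    by (rule forces_self_finite_sets)
  from forces_conj[OF forces_conj[OF RY g2] this]
  have "forces s (\<lambda>x. \<forall>N\<in>nb m e (ev M2 x). N \<in> {N. \<exists>\<sigma>. \<forall>n. N \<in> C (ini \<sigma> (Suc n)) x} \<longleftrightarrow> N \<in> - R [] x)"
  proof (rule forces_mono, intro ballI)
    fix x N
    assume x: "x \<in> cyl s"
      and all: "((\<forall>\<tau> N. infinite N \<longrightarrow> N \<inter> {m..} \<subseteq> ev M1 x \<longrightarrow> N \<in> R \<tau> x \<longrightarrow> N \<notin> Y \<tau> x) \<and>
        (\<forall>i n e. n \<in> ev M2 x \<longrightarrow> i \<le> n \<longrightarrow> e \<subseteq> {..n} \<longrightarrow>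
         (\<exists>k. \<forall>l\<ge>k. inside (Suc n) e (\<lambda>x. - Z (from_nat i) x) (ini x l) (trim (Suc n) M2)))) \<and>
        (\<forall>p e k. finite e \<longrightarrow> forces (ini x k) (\<psi> p e) \<longrightarrow> \<psi> p e x)"
      and N: "N \<in> nb m e (ev M2 x)"
    note a1 = conjunct1[OF conjunct1[OF all]] and a2 = conjunct2[OF conjunct1[OF all]]
      and a3 = conjunct2[OF all]
    have Ninf: "infinite N" using N by (simp add: nb_def)
    have NM1: "N \<inter> {m..} \<subseteq> ev M1 x" using N ev_below[OF M2 x] by (auto simp: nb_def)
    have noZ: "N \<notin> Z \<tau> x" for \<tau>
    proof -
      obtain n where n: "n \<in> N" "m + to_nat \<tau> \<le> n" using nb_unbounded[OF N] by blast
      have "n \<in> ev M2 x" using N n by (auto simp: nb_def)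
      from a2[rule_format, OF this, of "to_nat \<tau>" "N \<inter> {..n}"] n(2) obtain k where
        "inside (Suc n) (N \<inter> {..n}) (\<lambda>x. - Z \<tau> x) (ini x k) (trim (Suc n) M2)" by auto
      then have "forces (ini x k) (\<psi> (n, \<tau>) (N \<inter> {..n}))" by (simp add: inside_def \<psi>_def[abs_def])
      then have "\<psi> (n, \<tau>) (N \<inter> {..n}) x" using a3[rule_format, of "N \<inter> {..n}"] by simp
      moreover have "N \<in> nb (Suc n) (N \<inter> {..n}) (ev (trim (Suc n) M2) x)"
        using nb_next[OF N, of n] n(2) by (simp add: ev_trim)
      ultimately show ?thesis by (auto simp: \<psi>_def)
    qed
    show "N \<in> {N. \<exists>\<sigma>. \<forall>n. N \<in> C (ini \<sigma> (Suc n)) x} \<longleftrightarrow> N \<in> - R [] x"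
    proof
      assume "N \<in> {N. \<exists>\<sigma>. \<forall>n. N \<in> C (ini \<sigma> (Suc n)) x}"
      then have "N \<in> Y [] x" unfolding Y_def using cyl_Nil by blast
      then show "N \<in> - R [] x" using a1 Ninf NM1 by blast
    next
      assume R0: "N \<in> - R [] x"
      \<comment> \<open>Outside \<open>Z \<tau>\<close>, not being in \<open>R \<tau>\<close> means
        not being in \<open>E \<tau>\<close>, which yields membership in \<open>C \<tau>\<close> and
        a continuation outside \<open>R\<close>. Iteration from the empty sequence builds the branch
        \<open>\<sigma>\<close>.\<close>
      have stepE: "(\<tau> = [] \<or> N \<in> C \<tau> x) \<and> (\<exists>c. N \<notin> R (\<tau> @ [c]) x)" if "N \<notin> R \<tau> x" for \<tau>
        using noZ[of \<tau>] that NM1 unfolding Z_def E_def by (auto split: if_splits)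
      define f where "f \<tau> = (SOME c. N \<notin> R (\<tau> @ [c]) x)" for \<tau>
      define t where "t = rec_nat [] (\<lambda>n \<tau>. \<tau> @ [f \<tau>])"
      have t: "t 0 = []" "t (Suc n) = t n @ [f (t n)]" for n by (simp_all add: t_def)
      have tR: "N \<notin> R (t n) x" for n
      proof (induction n)
        case 0
        then show ?case using R0 by (simp add: t)
      next
        case (Suc n)
        then have "\<exists>c. N \<notin> R (t n @ [c]) x" using stepE by blast
        then show ?case unfolding t f_def by (rule someI_ex)
      qed
      have len: "length (t n) = n" for n by (induction n) (simp_all add: t)
      obtain \<sigma> where \<sigma>: "\<And>n. \<sigma> \<in> cyl (t n)" using chain_limit[of t] t(2) by auto
      have "ini \<sigma> n = t n" for n using \<sigma>[of n] len[of n] by (simp add: cyl_def)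
      then have "N \<in> C (ini \<sigma> (Suc n)) x" for n using stepE[OF tR[of "Suc n"]] by (auto simp: t(2))
      then show "N \<in> {N. \<exists>\<sigma>. \<forall>n. N \<in> C (ini \<sigma> (Suc n)) x}" by blast
    qed
  qed
  from UR_transfer[OF UR_compl[OF UR_R] e M2(1) this]
  obtain u M' where M': "name (s @ u) M'" "below (s @ u) M' M2"
    and dec: "inside m e (\<lambda>x. {N. \<exists>\<sigma>. \<forall>n. N \<in> C (ini \<sigma> (Suc n)) x}) (s @ u) M' \<or>
      inside m e (\<lambda>x. - {N. \<exists>\<sigma>. \<forall>n. N \<in> C (ini \<sigma> (Suc n)) x}) (s @ u) M'" by blast
  have "below (s @ u) M' A"
    using below_trans[OF M'(2) below_append[OF below_trans[OF M2(2) M1(2)]]] .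
  then show "\<exists>u M. name (s @ u) M \<and> below (s @ u) M A \<and>
     (inside m e (\<lambda>x. {N. \<exists>\<sigma>. \<forall>n. N \<in> C (ini \<sigma> (Suc n)) x}) (s @ u) M \<or>
      inside m e (\<lambda>x. - {N. \<exists>\<sigma>. \<forall>n. N \<in> C (ini \<sigma> (Suc n)) x}) (s @ u) M)"
    using M'(1) dec by blast
qed

text \<open>Induction over the generation of \<open>Cmeas\<close>, as preimages commute with all the
  operations. Joint continuity of \<open>g\<close> handles the open sets. Complements are taken in
  \<open>Pinf\<close>; they pull back to complements because \<open>g x N\<close> is
  infinite.\<close>

lemma UR_Cmeas_preimage:
  assumes "U \<in> Cmeas"
    and cont: "\<And>x N n. infinite N \<Longrightarrow> \<exists>k m. \<forall>x'\<in>cyl (ini x k). \<forall>N'. infinite N' \<longrightarrow>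
      N' \<inter> {..<m} = N \<inter> {..<m} \<longrightarrow> g x' N' \<inter> {..<n} = g x N \<inter> {..<n}"
    and inf: "\<And>x N. infinite N \<Longrightarrow> infinite (g x N)"
  shows "UR (\<lambda>x. {N. g x N \<in> U})"
  using assms(1)
proof (induction U rule: Cmeas.induct)
  case (open_Cmeas U)
  have "open_rel (\<lambda>x. {N. g x N \<in> U})" unfolding open_rel_def
  proof (intro allI ballI impI)
    fix x N assume N: "N \<in> {N. g x N \<in> U}" "infinite N"
    then obtain n where n: "\<forall>B\<in>Pinf. B \<inter> {..<n} = g x N \<inter> {..<n} \<longrightarrow> B \<in> U"
      using open_Cmeas unfolding open_Pinf_def by blast
    have "g x' N' \<in> U" if "infinite N'" "g x' N' \<inter> {..<n} = g x N \<inter> {..<n}" for x' N'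
      using n that inf unfolding Pinf_def by blast
    then show "\<exists>k m. \<forall>x'\<in>cyl (ini x k). \<forall>N'. infinite N' \<longrightarrow> N' \<inter> {..<m} = N \<inter> {..<m} \<longrightarrow> N' \<in> {N. g x' N \<in> U}"
      using cont[OF N(2), of x n] by (metis (no_types, lifting) mem_Collect_eq)
  qed
  then show ?case by (rule UR_open)
next
  case (compl_Cmeas U)
  show ?case by (rule UR_cong[OF UR_compl[OF compl_Cmeas.IH]]) (simp add: Pinf_def inf)
next
  case (Union_Cmeas F)
  show ?case by (rule UR_cong[OF UR_UN[OF Union_Cmeas.IH]]) simp
next
  case (Souslin_Cmeas S)
  show ?case by (rule UR_cong[OF UR_Souslin[OF Souslin_Cmeas.IH]]) (simp add: ini_def)
qed

section \<open>A tree of elements of \<open>\<A>\<close> with nodes in \<open>\<B>\<close>\<close>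

lemma countably_generated_in_UN:
  assumes "countable I" and "\<And>i. i \<in> I \<Longrightarrow> countably_generated_in (X i) \<D>"
  shows "countably_generated_in (\<Union>i\<in>I. X i) \<D>"
proof -
  have "\<forall>i\<in>I. \<exists>D. countable D \<and> D \<subseteq> \<D> \<and> (\<forall>A\<in>X i. \<exists>d\<in>D. finite (A - d))"
    using assms(2) unfolding countably_generated_in_def by blast
  from bchoice[OF this] obtain D where
    D: "\<forall>i\<in>I. countable (D i) \<and> D i \<subseteq> \<D> \<and> (\<forall>A\<in>X i. \<exists>d\<in>D i. finite (A - d))" by blast
  have "countable (\<Union>i\<in>I. D i)" using assms(1) D by (intro countable_UN) auto
  moreover have "(\<Union>i\<in>I. D i) \<subseteq> \<D>" using D by blast
  moreover have "\<forall>A\<in>(\<Union>i\<in>I. X i). \<exists>d\<in>(\<Union>i\<in>I. D i). finite (A - d)"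
  proof
    fix A assume "A \<in> (\<Union>i\<in>I. X i)"
    then obtain i where i: "i \<in> I" "A \<in> X i" by blast
    then obtain d where "d \<in> D i" "finite (A - d)" using D by blast
    then show "\<exists>d\<in>(\<Union>i\<in>I. D i). finite (A - d)" using i(1) by blast
  qed
  ultimately show ?thesis unfolding countably_generated_in_def
    by (intro exI[of _ "\<Union>i\<in>I. D i"] conjI)
qed

lemma countably_generated_in_subset:
  "countably_generated_in X \<D> \<Longrightarrow> X' \<subseteq> X \<Longrightarrow> countably_generated_in X' \<D>"
  unfolding countably_generated_in_def by (meson subsetD)

lemma countably_generated_in_Un:
  assumes "countably_generated_in X \<D>" "countably_generated_in X' \<D>"
  shows "countably_generated_in (X \<union> X') \<D>"
proof -
  have "countably_generated_in (\<Union>b\<in>(UNIV::bool set). if b then X else X') \<D>"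
    using assms by (intro countably_generated_in_UN) auto
  then show ?thesis by (rule countably_generated_in_subset) (auto split: if_splits)
qed

text \<open>Otherwise, by heredity, \<open>\<Union>X\<close> meets each member of
  \<open>\<B>\<close> in a finite set, and this single element of \<open>perp \<B>\<close> generates
  \<open>X\<close>.\<close>

lemma meets_perp:
  assumes "X \<subseteq> Pinf" "hereditary \<B>" "\<not> countably_generated_in X (perp \<B>)"
  shows "\<exists>E\<in>\<B>. E \<subseteq> \<Union>X \<and> infinite E"
proof (rule ccontr)
  assume no: "\<not> ?thesis"
  have fin: "finite (\<Union>X \<inter> B)" if "B \<in> \<B>" for B
  proof (rule ccontr)
    assume i: "infinite (\<Union>X \<inter> B)"
    then have "\<Union>X \<inter> B \<in> \<B>" using assms(2) that unfolding hereditary_def by blast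
    then show False using no i by blast
  qed
  have "X \<noteq> {}" using assms(3) unfolding countably_generated_in_def by auto
  then obtain A where A: "A \<in> X" by blast
  then have "infinite A" using assms(1) by (auto simp: Pinf_def)
  then have "infinite (\<Union>X)" using A finite_subset[of A "\<Union>X"] by blast
  then have "\<Union>X \<in> perp \<B>" using fin by (simp add: perp_def Pinf_def)
  moreover have "finite (A - \<Union>X)" if "A \<in> X" for A
  proof -
    have "A - \<Union>X = {}" using that by blast
    then show ?thesis by (simp only: finite.emptyI)
  qed
  ultimately have "countably_generated_in X (perp \<B>)"
    unfolding countably_generated_in_def by (intro exI[of _ "{\<Union>X}"]) simp
  then show False using assms(3) by blast
qed

text \<open>A Cantor-Bendixson argument for the ideal of countably generated families. Cylinders
  with countably generated image are discarded. There are only countably many, so below any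
  remaining node the surviving points still give a family that is not countably generated, and
  \<open>meets_perp\<close> finds a member of \<open>\<B>\<close> inside its union. Each element of
  that set lies in \<open>f \<sigma>\<close> for a survivor \<open>\<sigma>\<close>; continuity
  secures this on a longer remaining node, where the construction continues.\<close>

lemma analytic_tree:
  assumes hA: "hereditary \<A>" and hB: "hereditary \<B>" and an: "analytic \<A>"
    and ncg: "\<not> countably_generated_in \<A> (perp \<B>)"
  obtains v :: "nat list \<Rightarrow> nat \<Rightarrow> nat" where
    "\<And>s p. p + length s \<le> v s p" "\<And>s I. infinite I \<Longrightarrow> v s ` I \<in> \<B>"
    "\<And>x. range (\<lambda>k. v (ini x k) (x k)) \<in> \<A>"
proof -
  have "\<A> \<noteq> {}" using ncg unfolding countably_generated_in_def by auto
  then obtain f where f: "baire_to_cantor_continuous f" "range f = \<A>"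
    using an unfolding analytic_def by blast
  have AP: "\<A> \<subseteq> Pinf" using an unfolding analytic_def by blast
  define small where "small s \<longleftrightarrow> countably_generated_in (f ` cyl s) (perp \<B>)" for s
  define X where "X s = f ` {\<sigma> \<in> cyl s. \<forall>k. \<not> small (ini \<sigma> k)}" for s
  have Xs: "\<not> countably_generated_in (X s) (perp \<B>)" if "\<not> small s" for s
  proof
    assume c: "countably_generated_in (X s) (perp \<B>)"
    have "countably_generated_in (\<Union>t\<in>{t. small t}. f ` cyl t) (perp \<B>)"
      by (rule countably_generated_in_UN) (auto simp: small_def)
    from countably_generated_in_Un[OF c this]
    have "countably_generated_in (f ` cyl s) (perp \<B>)"
    proof (rule countably_generated_in_subset)
      show "f ` cyl s \<subseteq> X s \<union> (\<Union>t\<in>{t. small t}. f ` cyl t)"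
        unfolding X_def using ini_in_cyl by blast
    qed
    then show False using that by (simp add: small_def)
  qed
  define E where "E s = (SOME E. E \<in> \<B> \<and> E \<subseteq> \<Union>(X s) \<and> infinite E)" for s
  have E: "E s \<in> \<B> \<and> E s \<subseteq> \<Union>(X s) \<and> infinite (E s)" if "\<not> small s" for s
  proof -
    have "X s \<subseteq> Pinf" using AP f(2) unfolding X_def by blast
    then have "\<exists>E. E \<in> \<B> \<and> E \<subseteq> \<Union>(X s) \<and> infinite E" using meets_perp[OF _ hB Xs[OF that]] by blast
    then show ?thesis unfolding E_def by (rule someI_ex)
  qed
  \<comment> \<open>The lower bound \<open>p + l\<close> makes the values at a node unbounded over
    any infinite set of successors, and likewise those along a branch. It also ensures later that
    values below \<open>n\<close> involve only levels and entries below \<open>n\<close>.\<close>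
  define pick where "pick \<tau> l p = (LEAST n. n \<in> E \<tau> \<and> p + l \<le> n)" for \<tau> l p
  have pick: "pick \<tau> l p \<in> E \<tau> \<and> p + l \<le> pick \<tau> l p" if "\<not> small \<tau>" for \<tau> l p
  proof -
    have "\<exists>n. n \<in> E \<tau> \<and> p + l \<le> n" using E[OF that] by (auto simp: infinite_nat_iff_unbounded_le)
    then show ?thesis unfolding pick_def by (rule LeastI_ex)
  qed
  have ex_ext: "\<exists>\<tau>'. (\<exists>u. u \<noteq> [] \<and> \<tau>' = \<tau> @ u) \<and> \<not> small \<tau>' \<and> (\<forall>\<sigma>\<in>cyl \<tau>'. n \<in> f \<sigma>)"
    if ns: "\<not> small \<tau>" and n: "n \<in> E \<tau>" for \<tau> n
  proof -
    obtain \<sigma> where \<sigma>: "\<sigma> \<in> cyl \<tau>" "\<forall>k. \<not> small (ini \<sigma> k)" "n \<in> f \<sigma>"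
      using E[OF ns] n unfolding X_def by blast
    have "\<exists>m. \<forall>\<sigma>'. (\<forall>i<m. \<sigma>' i = \<sigma> i) \<longrightarrow> f \<sigma>' \<inter> {..<Suc n} = f \<sigma> \<inter> {..<Suc n}"
      using f(1) unfolding baire_to_cantor_continuous_def by blast
    then obtain m where m: "\<And>\<sigma>'. (\<And>i. i < m \<Longrightarrow> \<sigma>' i = \<sigma> i) \<Longrightarrow> f \<sigma>' \<inter> {..<Suc n} = f \<sigma> \<inter> {..<Suc n}" by blast
    let ?\<tau> = "ini \<sigma> (m + Suc (length \<tau>))"
    obtain u where u: "?\<tau> = \<tau> @ u" using cyl_ini_ge[OF \<sigma>(1), of "m + Suc (length \<tau>)"] by auto
    have "length ?\<tau> = length \<tau> + length u" using arg_cong[OF u, of length] by simp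
    then have "u \<noteq> []" by auto
    moreover have "n \<in> f \<sigma>'" if "\<sigma>' \<in> cyl ?\<tau>" for \<sigma>'
    proof -
      have "\<sigma>' i = \<sigma> i" if i: "i < m" for i
        using cyl_nth[OF \<open>\<sigma>' \<in> cyl ?\<tau>\<close>, of i] i by (simp add: ini_def del: upt_Suc)
      then have "f \<sigma>' \<inter> {..<Suc n} = f \<sigma> \<inter> {..<Suc n}" by (rule m)
      then show ?thesis using \<sigma>(3) by auto
    qed
    ultimately show ?thesis using u \<sigma>(2) by blast
  qed
  define ext where "ext \<tau> n = (SOME \<tau>'. (\<exists>u. u \<noteq> [] \<and> \<tau>' = \<tau> @ u) \<and> \<not> small \<tau>' \<and> (\<forall>\<sigma>\<in>cyl \<tau>'. n \<in> f \<sigma>))" for \<tau> n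
  have ext: "(\<exists>u. u \<noteq> [] \<and> ext \<tau> n = \<tau> @ u) \<and> \<not> small (ext \<tau> n) \<and> (\<forall>\<sigma>\<in>cyl (ext \<tau> n). n \<in> f \<sigma>)"
    if "\<not> small \<tau>" "n \<in> E \<tau>" for \<tau> n
    unfolding ext_def by (rule someI_ex[OF ex_ext[OF that]])
  \<comment> \<open>\<open>tau\<close> translates a sequence of successor choices into a remaining
    node of the original tree, the last entry being processed last.\<close>
  define tau where "tau s = rec_list [] (\<lambda>p l \<tau>. ext \<tau> (pick \<tau> (length l) p)) (rev s)" for s
  have tau: "tau [] = []" "tau (s @ [p]) = ext (tau s) (pick (tau s) (length s) p)" for s p
    by (simp_all add: tau_def)
  have ns: "\<not> small (tau s)" for s
  proof (induction s rule: rev_induct)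
    case Nil
    have "cyl [] = UNIV" by auto
    then show ?case using ncg f(2) by (simp add: tau small_def)
  next
    case (snoc p s)
    then show ?case using ext pick by (simp add: tau)
  qed
  define v where "v s p = pick (tau s) (length s) p" for s p
  have v: "v s p \<in> E (tau s)" "p + length s \<le> v s p" for s p using pick[OF ns] by (auto simp: v_def)
  show thesis
  proof (rule that)
    show "p + length s \<le> v s p" for s p by (rule v)
    show "v s ` I \<in> \<B>" if "infinite I" for s I
    proof -
      have "infinite (v s ` I)"
        unfolding infinite_nat_iff_unbounded_le
      proof
        fix m
        obtain p where "p \<in> I" "m \<le> p" using \<open>infinite I\<close> by (auto simp: infinite_nat_iff_unbounded_le)
        then show "\<exists>n\<ge>m. n \<in> v s ` I" using v(2)[of p s] by (intro exI[of _ "v s p"]) auto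
      qed
      moreover have "v s ` I \<subseteq> E (tau s)" using v(1) by blast
      moreover have "E (tau s) \<in> \<B>" using E[OF ns] by blast
      ultimately show ?thesis using hB unfolding hereditary_def by blast
    qed
    show "range (\<lambda>k. v (ini x k) (x k)) \<in> \<A>" for x
    proof -
      have step: "(\<exists>u. u \<noteq> [] \<and> tau (ini x (Suc k)) = tau (ini x k) @ u) \<and>
          (\<forall>\<sigma>\<in>cyl (tau (ini x (Suc k))). v (ini x k) (x k) \<in> f \<sigma>)" for k
        using ext[OF ns v(1)[of "ini x k" "x k"]] by (simp add: ini_Suc tau v_def)
      obtain \<sigma> where \<sigma>: "\<And>k. \<sigma> \<in> cyl (tau (ini x k))"
        using chain_limit[of "\<lambda>k. tau (ini x k)"] step by blast
      have "range (\<lambda>k. v (ini x k) (x k)) \<subseteq> f \<sigma>" using step \<sigma> by blast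
      moreover have "infinite (range (\<lambda>k. v (ini x k) (x k)))"
        unfolding infinite_nat_iff_unbounded_le
      proof
        fix m
        have "m \<le> v (ini x m) (x m)" using v(2)[of "x m" "ini x m"] by simp
        then show "\<exists>n\<ge>m. n \<in> range (\<lambda>k. v (ini x k) (x k))" by blast
      qed
      moreover have "f \<sigma> \<in> \<A>" using f(2) by blast
      ultimately show ?thesis using hA unfolding hereditary_def by blast
    qed
  qed
qed

section \<open>Teeth along a branch\<close>

text \<open>In the increasing enumeration of \<open>N\<close> from index 0, the teeth are the pairs
  at positions \<open>2 * i\<close> and \<open>Suc (2 * i)\<close>. Leaving out the other
  consecutive pairs allows teeth to be prescribed freely, as long as each lies beyond the previous
  one.\<close>

definition tooth :: "nat set \<Rightarrow> nat \<Rightarrow> nat \<Rightarrow> bool" where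
  "tooth N a b \<longleftrightarrow> a \<in> N \<and> b \<in> N \<and> a < b \<and> N \<inter> {a<..<b} = {} \<and> even (card (N \<inter> {..<a}))"

definition teeth :: "(nat list \<Rightarrow> nat \<Rightarrow> nat) \<Rightarrow> (nat \<Rightarrow> nat) \<Rightarrow> nat set \<Rightarrow> nat set" where
  "teeth v x N = {v (ini x a) b |a b. tooth N a b}"

lemma tooth_cong:
  assumes "N \<inter> {..<n} = N' \<inter> {..<n}" "b < n"
  shows "tooth N a b \<longleftrightarrow> tooth N' a b"
proof (cases "a < b")
  case True
  have mem: "q \<in> N \<longleftrightarrow> q \<in> N'" if "q < n" for q
  proof -
    have "q \<in> N \<inter> {..<n} \<longleftrightarrow> q \<in> N' \<inter> {..<n}" by (simp only: assms(1))
    then show ?thesis using that by simp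
  qed
  have "N \<inter> {..<a} = N' \<inter> {..<a}" "N \<inter> {a<..<b} = N' \<inter> {a<..<b}" "a \<in> N \<longleftrightarrow> a \<in> N'" "b \<in> N \<longleftrightarrow> b \<in> N'"
    using mem True assms(2) by auto
  then show ?thesis by (simp add: tooth_def)
qed (simp add: tooth_def)

lemma teeth_cong:
  assumes v: "\<And>s p. p + length s \<le> v s p"
    and "ini x n = ini x' n" and N: "N \<inter> {..<n} = N' \<inter> {..<n}"
  shows "teeth v x N \<inter> {..<n} = teeth v x' N' \<inter> {..<n}"
proof -
  have "teeth v x N \<inter> {..<n} \<subseteq> teeth v x' N'"
    if "ini x n = ini x' n" "N \<inter> {..<n} = N' \<inter> {..<n}" for x x' N N'
  proof
    fix q assume q: "q \<in> teeth v x N \<inter> {..<n}"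
    then obtain a b where ab: "q = v (ini x a) b" "tooth N a b" unfolding teeth_def by blast
    \<comment> \<open>By the lower bound on \<open>v\<close>, a value below \<open>n\<close> comes
      from a tooth with both ends below \<open>n\<close>, where the data agree.\<close>
    have b: "b < n" using v[of b "ini x a"] q ab(1) by simp
    then have "a < n" using ab(2) by (simp add: tooth_def)
    then have "ini x a = ini x' a" using that(1) take_ini[of a n x] take_ini[of a n x'] by simp
    moreover have "tooth N' a b" using ab(2) tooth_cong[OF that(2) b] by simp
    ultimately show "q \<in> teeth v x' N'" using ab(1) unfolding teeth_def by auto
  qed
  from this[OF assms(2) N] this[OF assms(2)[symmetric] N[symmetric]] show ?thesis by blast
qed

text \<open>Of two successive pairs of neighbours in \<open>N\<close>, one begins at an even
  position.\<close>

lemma tooth_exists: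
  assumes "infinite N"
  shows "\<exists>a b. m \<le> a \<and> tooth N a b"
proof -
  have nxt: "\<exists>b\<in>N. a < b \<and> N \<inter> {a<..<b} = {}" for a
  proof -
    define b where "b = (LEAST b. b \<in> N \<and> a < b)"
    have "\<exists>b. b \<in> N \<and> a < b" using assms by (auto simp: infinite_nat_iff_unbounded)
    then have "b \<in> N \<and> a < b" unfolding b_def by (rule LeastI_ex)
    moreover have "N \<inter> {a<..<b} = {}" using not_less_Least[of _ "\<lambda>b. b \<in> N \<and> a < b"] unfolding b_def by fastforce
    ultimately show ?thesis by blast
  qed
  obtain a where a: "a \<in> N" "m \<le> a" using assms by (auto simp: infinite_nat_iff_unbounded_le)
  obtain b where b: "b \<in> N" "a < b" "N \<inter> {a<..<b} = {}" using nxt by blast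
  show ?thesis
  proof (cases "even (card (N \<inter> {..<a}))")
    case True
    then have "tooth N a b" using a b by (simp add: tooth_def)
    then show ?thesis using a(2) by blast
  next
    case False
    obtain c where c: "c \<in> N" "b < c" "N \<inter> {b<..<c} = {}" using nxt by blast
    have "{..<b} = insert a ({..<a} \<union> {a<..<b})" using b(2) by auto
    then have "N \<inter> {..<b} = insert a (N \<inter> {..<a})" using a(1) b(3) by auto
    then have "card (N \<inter> {..<b}) = Suc (card (N \<inter> {..<a}))" by simp
    then have "tooth N b c" using b(1) c False by (simp add: tooth_def)
    moreover have "m \<le> b" using a(2) b(2) by simp
    ultimately show ?thesis by blast
  qed
qed

lemma infinite_teeth:
  assumes v: "\<And>s p. p + length s \<le> v s p" and "infinite N"
  shows "infinite (teeth v x N)"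
  unfolding infinite_nat_iff_unbounded_le
proof
  fix m
  obtain a b where ab: "m \<le> a" "tooth N a b" using tooth_exists[OF assms(2)] by blast
  then have "m \<le> v (ini x a) b" using v[of b "ini x a"] by (simp add: tooth_def)
  then show "\<exists>n\<ge>m. n \<in> teeth v x N" using ab(2) unfolding teeth_def by blast
qed

lemma tooth_range:
  assumes c: "strict_mono (c :: nat \<Rightarrow> nat)" and "tooth (range c) a b"
  shows "\<exists>i. a = c (2 * i) \<and> b = c (Suc (2 * i))"
proof -
  obtain j j' where j: "a = c j" "b = c j'" using assms(2) by (auto simp: tooth_def)
  have "range c \<inter> {..<c j} = c ` {..<j}" using strict_mono_less[OF c] by auto
  moreover have "card (c ` {..<j}) = j"
    by (subst card_image) (use strict_mono_imp_inj_on[OF c] inj_on_subset in auto)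
  ultimately have "even j" using assms(2) j(1) by (simp add: tooth_def)
  have "j < j'" using assms(2) strict_mono_less[OF c] by (simp add: tooth_def j)
  moreover have "\<not> Suc j < j'"
  proof
    assume "Suc j < j'"
    then have "c (Suc j) \<in> range c \<inter> {a<..<b}" using strict_mono_less[OF c] by (simp add: j)
    then show False using assms(2) unfolding tooth_def by blast
  qed
  ultimately have "j' = Suc j" by simp
  then show ?thesis using \<open>even j\<close> j by (auto elim: evenE)
qed

text \<open>The M-property, applied to the successor sets of the nodes along \<open>x\<close> with
  levels and entries in \<open>L\<close>, gives a \<open>B\<close> in \<open>\<B>\<close> almost
  covered by the successor sets of any tail. Since \<open>F\<close> takes only finitely many points
  of \<open>B\<close>, there are arbitrarily high pairs from \<open>L\<close> with value in
  \<open>B - F\<close>; strung together, they are the teeth of a set \<open>N\<close>.\<close>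

lemma teeth_dense:
  assumes v: "\<And>s p. p + length s \<le> v s p" and vB: "\<And>s I. infinite I \<Longrightarrow> v s ` I \<in> \<B>"
    and B: "is_M_family \<B>" "\<B> \<subseteq> Pinf" and L: "infinite L"
    and F: "\<And>B. B \<in> \<B> \<Longrightarrow> finite (F \<inter> B)"
  shows "\<exists>N\<subseteq>L. infinite N \<and> teeth v x N \<in> \<B> \<and> teeth v x N \<inter> F = {}"
proof -
  define An where "An n = v (ini x (enumerate L n)) ` (L \<inter> {enumerate L n<..})" for n
  have "infinite (L \<inter> {k<..})" for k
  proof -
    have "L \<subseteq> (L \<inter> {k<..}) \<union> {..k}" by auto
    then show ?thesis using L finite_subset by blast
  qed
  then have "\<forall>n. An n \<in> \<B>" using vB by (simp add: An_def)
  then obtain B where B1: "B \<in> \<B>" "\<forall>n. finite (B - (\<Union>i\<in>{n..}. An i))"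
    using B(1) unfolding is_M_family_def by blast
  define B' where "B' = B - F"
  have "infinite B" using B1(1) B(2) by (auto simp: Pinf_def)
  moreover have "B = B' \<union> (F \<inter> B)" by (auto simp: B'_def)
  ultimately have B'inf: "infinite B'" using F[OF B1(1)] by (metis finite_Un)
  have her: "hereditary \<B>" using B(1) by (simp add: is_M_family_def)
  have ex: "\<exists>p. fst p \<in> L \<and> snd p \<in> L \<and> m \<le> fst p \<and> fst p < snd p \<and> v (ini x (fst p)) (snd p) \<in> B'" for m
  proof -
    have "finite (B' - (\<Union>i\<in>{m..}. An i))"
      by (rule finite_subset[OF _ B1(2)[rule_format, of m]]) (auto simp: B'_def)
    then have "B' \<inter> (\<Union>i\<in>{m..}. An i) \<noteq> {}" using B'inf by (metis Diff_triv)
    then obtain i q where i: "m \<le> i" "q \<in> An i" "q \<in> B'" by auto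
    then obtain b where b: "b \<in> L" "enumerate L i < b" "q = v (ini x (enumerate L i)) b" by (auto simp: An_def)
    have "m \<le> enumerate L i" using le_enumerate[OF L, of i] i(1) by simp
    then show ?thesis using b i(3) enumerate_in_set[OF L, of i] by (intro exI[of _ "(enumerate L i, b)"]) auto
  qed
  define h where "h m = (SOME p. fst p \<in> L \<and> snd p \<in> L \<and> m \<le> fst p \<and> fst p < snd p \<and> v (ini x (fst p)) (snd p) \<in> B')" for m
  have h: "fst (h m) \<in> L" "snd (h m) \<in> L" "m \<le> fst (h m)" "fst (h m) < snd (h m)"
    "v (ini x (fst (h m))) (snd (h m)) \<in> B'" for m
    using someI_ex[OF ex[of m]] unfolding h_def by blast+
  \<comment> \<open>Each pair starts beyond the upper end of the preceding one, so the sequence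
    \<open>c\<close> of end points is strictly increasing and its teeth are exactly these
    pairs.\<close>
  define p where "p = rec_nat (h 0) (\<lambda>i q. h (Suc (snd q)))"
  have pS: "p (Suc i) = h (Suc (snd (p i)))" for i by (simp add: p_def)
  have ph: "\<exists>m. p i = h m" for i by (cases i) (auto simp: p_def)
  have p: "fst (p i) \<in> L" "snd (p i) \<in> L" "fst (p i) < snd (p i)"
    "v (ini x (fst (p i))) (snd (p i)) \<in> B'" for i
    using ph[of i] h by auto
  define c where "c j = (if even j then fst (p (j div 2)) else snd (p (j div 2)))" for j
  have c2: "c (2 * i) = fst (p i)" "c (Suc (2 * i)) = snd (p i)" for i by (simp_all add: c_def)
  have "c j < c (Suc j)" for j
  proof (cases "even j")
    case True
    then show ?thesis using p(3) by (auto simp: c_def elim: evenE)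
  next
    case False
    then obtain i where "j = Suc (2 * i)" by (auto elim: oddE)
    then show ?thesis using c2[of i] c2[of "Suc i"] pS[of i] h(3)[of "Suc (snd (p i))"] by simp
  qed
  then have mono: "strict_mono c" by (simp add: strict_mono_Suc_iff)
  have sub: "range c \<subseteq> L" using p by (auto simp: c_def)
  have inf: "infinite (range c)" using strict_mono_imp_inj_on[OF mono] range_inj_infinite by blast
  have tB: "teeth v x (range c) \<subseteq> B'"
  proof
    fix q assume "q \<in> teeth v x (range c)"
    then obtain a b where ab: "q = v (ini x a) b" "tooth (range c) a b" unfolding teeth_def by blast
    obtain i where "a = c (2 * i)" "b = c (Suc (2 * i))" using tooth_range[OF mono ab(2)] by blast
    then show "q \<in> B'" using ab(1) p(4)[of i] by (simp add: c2)
  qed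
  have "teeth v x (range c) \<subseteq> B" using tB by (auto simp: B'_def)
  then have "teeth v x (range c) \<in> \<B>"
    using her B1(1) infinite_teeth[OF v inf, of x] unfolding hereditary_def by blast
  moreover have "teeth v x (range c) \<inter> F = {}" using tB by (auto simp: B'_def)
  ultimately show ?thesis using sub inf by blast
qed

text \<open>The continuous map \<open>teeth\<close> pulls \<open>\<B>\<close> back to a uniformly
  Ramsey relation, and meeting the branch set is an open relation. A negative decision would be
  contradicted at a generic point by \<open>teeth_dense\<close>, with the branch set as
  \<open>F\<close>. So the decision is positive, and it applies to the value \<open>ev M x\<close>
  itself.\<close>

lemma generic_teeth:
  assumes v: "\<And>s p. p + length s \<le> v s p" and vB: "\<And>s I. infinite I \<Longrightarrow> v s ` I \<in> \<B>"
    and vA: "\<And>x. range (\<lambda>k. v (ini x k) (x k)) \<in> \<A>"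
    and B: "C_measurable \<B>" "is_M_family \<B>" "\<B> \<subseteq> Pinf" and AB: "orth \<A> \<B>"
  shows "\<exists>s M. name s M \<and> forces s (\<lambda>x. infinite (ev M x) \<and> teeth v x (ev M x) \<in> \<B> \<and>
    teeth v x (ev M x) \<inter> range (\<lambda>k. v (ini x k) (x k)) = {})"
proof -
  define W where "W x = {N. teeth v x N \<inter> range (\<lambda>k. v (ini x k) (x k)) \<noteq> {}}" for x
  have "UR (\<lambda>x. {N. teeth v x N \<in> \<B>})"
  proof (rule UR_Cmeas_preimage)
    show "\<B> \<in> Cmeas" using B(1) by (simp add: C_measurable_def)
    show "infinite (teeth v x N)" if "infinite N" for x N by (rule infinite_teeth[OF v that])
    show "\<exists>k m. \<forall>x'\<in>cyl (ini x k). \<forall>N'. infinite N' \<longrightarrow> N' \<inter> {..<m} = N \<inter> {..<m} \<longrightarrow>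
        teeth v x' N' \<inter> {..<n} = teeth v x N \<inter> {..<n}" for x N n
    proof (intro exI[of _ n] ballI allI impI)
      fix x' N' assume "x' \<in> cyl (ini x n)" "N' \<inter> {..<n} = N \<inter> {..<n}"
      then show "teeth v x' N' \<inter> {..<n} = teeth v x N \<inter> {..<n}"
        by (intro teeth_cong[OF v cyl_ini_le[OF _ order_refl]])
    qed
  qed
  moreover have "open_rel W" unfolding open_rel_def
  proof (intro allI ballI impI)
    fix x N assume "N \<in> W x"
    then obtain k where k: "v (ini x k) (x k) \<in> teeth v x N" by (auto simp: W_def)
    let ?q = "v (ini x k) (x k)"
    \<comment> \<open>Agreement below this bound preserves both the tooth of value \<open>?q\<close>
      and the entry of \<open>x\<close> at level \<open>k\<close> that produces the same value on
      the branch.\<close>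
    let ?n = "Suc (?q + k)"
    show "\<exists>k m. \<forall>x'\<in>cyl (ini x k). \<forall>N'. infinite N' \<longrightarrow> N' \<inter> {..<m} = N \<inter> {..<m} \<longrightarrow> N' \<in> W x'"
    proof (intro exI[of _ ?n] ballI allI impI)
      fix x' N' assume x': "x' \<in> cyl (ini x ?n)" and N': "N' \<inter> {..<?n} = N \<inter> {..<?n}"
      have "ini x' ?n = ini x ?n" using cyl_ini_le[OF x', of ?n] by simp
      note eq = teeth_cong[OF v this N']
      have "?q \<in> teeth v x N \<inter> {..<?n}" using k by simp
      then have "?q \<in> teeth v x' N'" unfolding eq[symmetric] by blast
      moreover have "ini x' (Suc k) = ini x (Suc k)" using cyl_ini_le[OF x', of "Suc k"] by simp
      then have "?q = v (ini x' k) (x' k)" by (simp add: ini_Suc)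
      ultimately show "N' \<in> W x'" unfolding W_def by blast
    qed
  qed
  ultimately have URY: "UR (\<lambda>x. {N. teeth v x N \<in> \<B>} \<inter> - W x)" using UR_Int[OF _ UR_compl[OF UR_open]] by blast
  have "name ([] @ []) (\<lambda>_. UNIV)" by (auto simp: name_def)
  from URD[OF URY empty_subsetI this] obtain s M where M: "name s M"
    and d: "inside 0 {} (\<lambda>x. {N. teeth v x N \<in> \<B>} \<inter> - W x) s M \<or>
      inside 0 {} (\<lambda>x. - ({N. teeth v x N \<in> \<B>} \<inter> - W x)) s M"
    unfolding append_Nil by blast
  have "\<not> inside 0 {} (\<lambda>x. - ({N. teeth v x N \<in> \<B>} \<inter> - W x)) s M"
  proof
    assume "inside 0 {} (\<lambda>x. - ({N. teeth v x N \<in> \<B>} \<inter> - W x)) s M"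
    from forces_witness[OF forces_conj[OF this[unfolded inside_def] forces_infinite_ev[OF M]]]
    obtain x where x: "nb 0 {} (ev M x) \<subseteq> - ({N. teeth v x N \<in> \<B>} \<inter> - W x)" "infinite (ev M x)" by blast
    have "finite (range (\<lambda>k. v (ini x k) (x k)) \<inter> B)" if "B \<in> \<B>" for B
      using AB vA that unfolding orth_def by blast
    from teeth_dense[OF v vB B(2,3) x(2) this, of x]
    obtain N where "N \<subseteq> ev M x" "infinite N" "teeth v x N \<in> \<B>"
      "teeth v x N \<inter> range (\<lambda>k. v (ini x k) (x k)) = {}" by blast
    moreover from this have "N \<in> nb 0 {} (ev M x)" by (auto simp: nb_def)
    ultimately show False using x(1) by (auto simp: W_def)
  qed
  then have "forces s (\<lambda>x. nb 0 {} (ev M x) \<subseteq> {N. teeth v x N \<in> \<B>} \<inter> - W x)"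
    using d by (simp add: inside_def)
  from forces_conj[OF this forces_infinite_ev[OF M]]
  have "forces s (\<lambda>x. infinite (ev M x) \<and> teeth v x (ev M x) \<in> \<B> \<and>
    teeth v x (ev M x) \<inter> range (\<lambda>k. v (ini x k) (x k)) = {})"
  proof (rule forces_mono)
    fix x assume a: "nb 0 {} (ev M x) \<subseteq> {N. teeth v x N \<in> \<B>} \<inter> - W x \<and> infinite (ev M x)"
    then have "ev M x \<in> nb 0 {} (ev M x)" by (simp add: nb_def)
    then have "ev M x \<in> {N. teeth v x N \<in> \<B>} \<inter> - W x" using a by blast
    then show "infinite (ev M x) \<and> teeth v x (ev M x) \<in> \<B> \<and>
      teeth v x (ev M x) \<inter> range (\<lambda>k. v (ini x k) (x k)) = {}" using a by (simp add: W_def)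
  qed
  then show ?thesis using M by blast
qed

section \<open>The perfect gap\<close>

definition decides :: "(nat list \<Rightarrow> nat set) \<Rightarrow> nat \<Rightarrow> nat list set" where
  "decides M n = {t. n \<in> M t \<or> (\<forall>w. n \<notin> M (t @ w))}"

lemma decides_dense: "\<exists>w. t @ w \<in> decides M n"
proof (cases "\<exists>w. n \<in> M (t @ w)")
  case False
  then have "t @ [] \<in> decides M n" by (simp add: decides_def)
  then show ?thesis by blast
qed (auto simp: decides_def)

lemma ev_decided:
  assumes M: "name s M" and t: "t \<in> decides M n" and x: "x \<in> cyl t"
  shows "n \<in> ev M x \<longleftrightarrow> n \<in> M t"
proof
  assume "n \<in> M t"
  then show "n \<in> ev M x" using x unfolding ev_def cyl_def by (auto intro!: exI[of _ "length t"])
next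
  assume "n \<in> ev M x"
  then obtain k where k: "n \<in> M (ini x k)" by (auto simp: ev_def)
  let ?l = "max k (length t)"
  obtain w where "ini x ?l = t @ w" using cyl_ini_ge[OF x, of ?l] by auto
  moreover have "n \<in> M (ini x ?l)" using k name_mono_ini[OF M, of k ?l x] by auto
  ultimately show "n \<in> M t" using t by (auto simp: decides_def)
qed

text \<open>Dense sets need not be closed under extension, so membership in the closure under
  extension is what persists along a construction.\<close>

definition hits :: "nat list \<Rightarrow> nat list set \<Rightarrow> bool" where
  "hits t D \<longleftrightarrow> (\<exists>r u. t = r @ u \<and> r \<in> D)"

lemma hits_append: "hits t D \<Longrightarrow> hits (t @ u) D"
  unfolding hits_def by (metis append.assoc)

lemma hits_ini: "hits t D \<Longrightarrow> x \<in> cyl t \<Longrightarrow> \<exists>k. ini x k \<in> D"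
  unfolding hits_def using cyl_append cyl_iniD by metis

lemma ini_hits: "ini x k \<in> D \<Longrightarrow> k \<le> l \<Longrightarrow> hits (ini x l) D"
  unfolding hits_def using ini_le by metis

lemma hits_decides:
  assumes "name s M" "hits t (decides M n)" "x \<in> cyl t" "x' \<in> cyl t"
  shows "n \<in> ev M x \<longleftrightarrow> n \<in> ev M x'"
proof -
  obtain r u where r: "t = r @ u" "r \<in> decides M n" using assms(2) by (auto simp: hits_def)
  then have "x \<in> cyl r" "x' \<in> cyl r" using assms(3,4) cyl_append by auto
  then show ?thesis using ev_decided[OF assms(1) r(2)] by blast
qed

text \<open>A generic \<open>x\<close> through \<open>s @ w\<close> has a tooth
  \<open>(a, b)\<close> with \<open>a\<close> past this node. \<open>t0\<close> follows
  \<open>x\<close> until the tooth is decided; \<open>t1\<close> follows \<open>x\<close> up to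
  level \<open>a\<close> and then takes the entry \<open>b\<close>. For \<open>y\<close> through the
  second node and \<open>z\<close> through the first, the number \<open>v (ini y a) b\<close> will
  thus lie on the branch of \<open>y\<close> and among the teeth of \<open>z\<close>.\<close>

lemma splitting_step:
  fixes D :: "nat \<Rightarrow> nat list set"
  assumes M: "name s M" and D: "\<And>i t. \<exists>u. t @ u \<in> D i"
    and inf: "\<forall>x\<in>cyl s. (\<forall>i. \<exists>k. ini x k \<in> D i) \<longrightarrow> infinite (ev M x)"
  shows "\<exists>t0 t1 r a b. length r = a \<and> t0 \<noteq> [] \<and> t1 \<noteq> [] \<and>
    hits (s @ w @ t0) (D i) \<and> hits (s @ w @ t0) (decides M i) \<and>
    hits (s @ w @ t1) (D i) \<and> hits (s @ w @ t1) (decides M i) \<and>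
    (\<exists>u. s @ w @ t0 = r @ u) \<and> (\<exists>u. s @ w @ t1 = r @ [b] @ u) \<and>
    (\<forall>x\<in>cyl (s @ w @ t0). tooth (ev M x) a b)"
proof -
  have "forces (s @ w) (\<lambda>x. (\<forall>i. \<exists>k. ini x k \<in> D i) \<and> (\<forall>n. \<exists>k. ini x k \<in> decides M n))"
  proof (intro forces_conj forces_all forces_meets)
    show "\<exists>z. (s @ w) @ u @ z \<in> D i" for i u using D[of "(s @ w) @ u" i] by simp
    show "\<exists>z. (s @ w) @ u @ z \<in> decides M n" for n u using decides_dense[of "(s @ w) @ u" M n] by simp
  qed
  from forces_witness[OF this] obtain x where x: "x \<in> cyl (s @ w)"
    and xD: "\<And>i. \<exists>k. ini x k \<in> D i" and xM: "\<And>n. \<exists>k. ini x k \<in> decides M n" by blast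
  have "infinite (ev M x)" using inf cyl_append[OF x] xD by blast
  then obtain a b where ab: "length (s @ w) \<le> a" "tooth (ev M x) a b" using tooth_exists by blast
  obtain k0 where k0: "ini x k0 \<in> D i" using xD by blast
  obtain k where k: "\<And>n. ini x (k n) \<in> decides M n" using xM by metis
  \<comment> \<open>Long enough to meet \<open>D i\<close> and \<open>decides M i\<close>, to pass
    level \<open>a\<close>, and to settle which numbers up to \<open>b\<close> are in the value,
    hence the tooth.\<close>
  define l where "l = Suc a + k0 + k i + (\<Sum>n\<le>b. k n)"
  have kl: "k n \<le> l" if "n \<le> b" for n
    using member_le_sum[of n "{..b}" k] that by (simp add: l_def)
  obtain t0 where t0: "ini x l = (s @ w) @ t0" using cyl_ini_ge[OF x, of l] ab(1) by (auto simp: l_def)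
  have "length (ini x l) = length (s @ w) + length t0" using t0 by (metis length_append)
  then have t0n: "t0 \<noteq> []" using ab(1) by (auto simp: l_def)
  have tooth0: "tooth (ev M x') a b" if x': "x' \<in> cyl (ini x l)" for x'
  proof -
    have "n \<in> ev M x' \<longleftrightarrow> n \<in> ev M x" if "n \<le> b" for n
      using hits_decides[OF M ini_hits[OF k kl[OF that]] x' ini_in_cyl] .
    then have "ev M x' \<inter> {..<Suc b} = ev M x \<inter> {..<Suc b}" by auto
    then show ?thesis using tooth_cong[of "ev M x'" "Suc b" "ev M x" b a] ab(2) by simp
  qed
  obtain z where z: "ini x a = (s @ w) @ z" using cyl_ini_ge[OF x ab(1)] by blast
  obtain u1 where u1: "(ini x a @ [b]) @ u1 \<in> D i" using D by blast
  obtain u2 where u2: "((ini x a @ [b]) @ u1) @ u2 \<in> decides M i" using decides_dense by blast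
  define t1 where "t1 = z @ [b] @ u1 @ u2"
  have t1: "s @ w @ t1 = ini x a @ [b] @ u1 @ u2" by (simp add: t1_def z)
  have t0': "s @ w @ t0 = ini x l" using t0 by simp
  have "hits (s @ w @ t1) (D i)" unfolding hits_def t1
    using u1 by (intro exI[of _ "(ini x a @ [b]) @ u1"] exI[of _ u2]) simp
  moreover have "hits (s @ w @ t1) (decides M i)" unfolding hits_def t1
    using u2 by (intro exI[of _ "((ini x a @ [b]) @ u1) @ u2"] exI[of _ "[]"]) simp
  moreover have "hits (s @ w @ t0) (D i)" unfolding t0' by (rule ini_hits[OF k0]) (simp add: l_def)
  moreover have "hits (s @ w @ t0) (decides M i)" unfolding t0' by (rule ini_hits[OF k]) (simp add: l_def)
  moreover have "\<exists>u. s @ w @ t0 = ini x a @ u" unfolding t0' by (rule ini_le) (simp add: l_def)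
  moreover have "\<exists>u. s @ w @ t1 = ini x a @ [b] @ u" unfolding t1 by blast
  moreover have "t1 \<noteq> []" by (simp add: t1_def)
  moreover have "\<forall>x\<in>cyl (s @ w @ t0). tooth (ev M x) a b" unfolding t0' using tooth0 by blast
  ultimately show ?thesis using t0n length_ini[of x a] by blast
qed

text \<open>The splitting step is iterated along \<open>z\<close>. The node at stage
  \<open>n\<close> depends only on \<open>z \<inter> {..<n}\<close>, has length at least
  \<open>n\<close> and decides all numbers below \<open>n\<close>, which gives continuity. Every
  \<open>D i\<close> is met on the way, so all branches are generic, and the first difference of two
  branches provides the tooth.\<close>

lemma perfect_tree:
  fixes D :: "nat \<Rightarrow> nat list set"
  assumes M: "name s M" and D: "\<And>i t. \<exists>u. t @ u \<in> D i"
    and inf: "\<forall>x\<in>cyl s. (\<forall>i. \<exists>k. ini x k \<in> D i) \<longrightarrow> infinite (ev M x)"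
  obtains X :: "nat set \<Rightarrow> nat \<Rightarrow> nat" where
    "\<And>z. X z \<in> cyl s" "\<And>z i. \<exists>k. ini (X z) k \<in> D i"
    "\<And>y z n. y \<inter> {..<n} = z \<inter> {..<n} \<Longrightarrow>
       ini (X y) n = ini (X z) n \<and> ev M (X y) \<inter> {..<n} = ev M (X z) \<inter> {..<n}"
    "\<And>y z n. y \<inter> {..<n} = z \<inter> {..<n} \<Longrightarrow> n \<in> y \<Longrightarrow> n \<notin> z \<Longrightarrow>
       \<exists>a. ini (X y) a = ini (X z) a \<and> tooth (ev M (X z)) a (X y a)"
proof -
  define ok where "ok i t p \<longleftrightarrow> (\<exists>t0 t1 r a b. p = (t @ t0, t @ t1) \<and> length r = a \<and> t0 \<noteq> [] \<and> t1 \<noteq> [] \<and>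
    hits (t @ t0) (D i) \<and> hits (t @ t0) (decides M i) \<and>
    hits (t @ t1) (D i) \<and> hits (t @ t1) (decides M i) \<and>
    (\<exists>u. t @ t0 = r @ u) \<and> (\<exists>u. t @ t1 = r @ [b] @ u) \<and>
    (\<forall>x\<in>cyl (t @ t0). tooth (ev M x) a b))" for i t p
  have okD: "\<exists>t0 t1. p = (t @ t0, t @ t1) \<and> t0 \<noteq> [] \<and> t1 \<noteq> [] \<and>
    hits (t @ t0) (D i) \<and> hits (t @ t0) (decides M i) \<and>
    hits (t @ t1) (D i) \<and> hits (t @ t1) (decides M i)" if "ok i t p" for i t p
    using that unfolding ok_def by (elim exE conjE) blast
  define nx where "nx i t = (SOME p. ok i t p)" for i t
  have nx: "ok i (s @ w) (nx i (s @ w))" for i w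
  proof -
    obtain t0 t1 r a b where "length r = a" "t0 \<noteq> []" "t1 \<noteq> []"
      "hits (s @ w @ t0) (D i)" "hits (s @ w @ t0) (decides M i)"
      "hits (s @ w @ t1) (D i)" "hits (s @ w @ t1) (decides M i)"
      "\<exists>u. s @ w @ t0 = r @ u" "\<exists>u. s @ w @ t1 = r @ [b] @ u"
      "\<forall>x\<in>cyl (s @ w @ t0). tooth (ev M x) a b"
      using splitting_step[where D = D, OF M D inf, where w = w and i = i] by (elim exE conjE) blast
    then have "ok i (s @ w) ((s @ w) @ t0, (s @ w) @ t1)" unfolding ok_def
      by (intro exI[of _ t0] exI[of _ t1] exI[of _ r] exI[of _ a] exI[of _ b]) simp
    then have "\<exists>p. ok i (s @ w) p" ..
    then show ?thesis unfolding nx_def by (rule someI_ex)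
  qed
  \<comment> \<open>Membership of \<open>i\<close> in \<open>z\<close> selects the side that takes
    the entry \<open>b\<close>; otherwise the side on which \<open>(a, b)\<close> is a tooth is
    selected.\<close>
  define T where "T z = rec_nat s (\<lambda>i t. if i \<in> z then snd (nx i t) else fst (nx i t))" for z :: "nat set"
  have T: "T z 0 = s" "T z (Suc i) = (if i \<in> z then snd (nx i (T z i)) else fst (nx i (T z i)))" for z i
    by (simp_all add: T_def)
  have Ts: "\<exists>w. T z i = s @ w" for z i
  proof (induction i)
    case (Suc i)
    then obtain w where w: "T z i = s @ w" by blast
    then show ?case using okD[OF nx[of i w]] unfolding T(2) by auto
  qed (simp add: T)
  have Tok: "ok i (T z i) (nx i (T z i))" for z i using Ts[of z i] nx by auto
  have Tstep: "(\<exists>u. u \<noteq> [] \<and> T z (Suc i) = T z i @ u) \<and> hits (T z (Suc i)) (D i) \<and>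
      hits (T z (Suc i)) (decides M i)" for z i
    using okD[OF Tok[of i z]] unfolding T(2) by auto
  have "\<exists>x. \<forall>i. x \<in> cyl (T z i)" for z by (rule chain_limit) (use Tstep in blast)
  then have "\<forall>z. \<exists>x. \<forall>i. x \<in> cyl (T z i)" by blast
  from choice[OF this] obtain X where X: "\<And>z i. X z \<in> cyl (T z i)" by blast
  have cong: "T y n = T z n" if "y \<inter> {..<n} = z \<inter> {..<n}" for y z n
    using that
  proof (induction n)
    case (Suc n)
    have mem: "q \<in> y \<longleftrightarrow> q \<in> z" if "q < Suc n" for q
    proof -
      have "q \<in> y \<inter> {..<Suc n} \<longleftrightarrow> q \<in> z \<inter> {..<Suc n}" by (simp only: Suc.prems)
      then show ?thesis using that by simp
    qed
    have "y \<inter> {..<n} = z \<inter> {..<n}" using mem by auto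
    then show ?case using Suc.IH mem[of n] by (simp add: T(2))
  qed (simp add: T)
  have len: "n \<le> length (T z n)" for z n
  proof (induction n)
    case (Suc n)
    obtain u where "u \<noteq> []" "T z (Suc n) = T z n @ u" using Tstep by blast
    then show ?case using Suc by (cases u) auto
  qed simp
  have ext: "\<exists>u. T z (i + j) = T z i @ u" for z i j
  proof (induction j)
    case (Suc j)
    then obtain u where "T z (i + j) = T z i @ u" by blast
    moreover obtain u' where "T z (Suc (i + j)) = T z (i + j) @ u'" using Tstep by blast
    ultimately show ?case by auto
  qed simp
  have dec: "hits (T z n) (decides M i)" if "i < n" for z i n
  proof -
    obtain u where "T z (Suc i + (n - Suc i)) = T z (Suc i) @ u" using ext by blast
    then have "T z n = T z (Suc i) @ u" using that by simp
    then show ?thesis using Tstep[of z i] hits_append by simp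
  qed
  show thesis
  proof (rule that[of X])
    show "X z \<in> cyl s" for z using X[of z 0] by (simp add: T)
    show "\<exists>k. ini (X z) k \<in> D i" for z i using hits_ini[OF _ X] Tstep by blast
  next
    fix y z :: "nat set" and n assume yz: "y \<inter> {..<n} = z \<inter> {..<n}"
    have Ty: "X y \<in> cyl (T z n)" using X[of y n] cong[OF yz] by simp
    have "ini (X y) (length (T z n)) = ini (X z) (length (T z n))"
      using Ty X[of z n] by (simp add: cyl_def)
    then have "ini (X y) n = ini (X z) n"
      using take_ini[OF len[of n z], of "X y"] take_ini[OF len[of n z], of "X z"] by simp
    moreover have "ev M (X y) \<inter> {..<n} = ev M (X z) \<inter> {..<n}"
      using hits_decides[OF M dec Ty X] by auto
    ultimately show "ini (X y) n = ini (X z) n \<and> ev M (X y) \<inter> {..<n} = ev M (X z) \<inter> {..<n}" by blast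
  next
    fix y z :: "nat set" and n assume yz: "y \<inter> {..<n} = z \<inter> {..<n}" and n: "n \<in> y" "n \<notin> z"
    obtain t0 t1 r a b where nxt: "nx n (T z n) = (T z n @ t0, T z n @ t1)" "length r = a"
      "\<exists>u. T z n @ t0 = r @ u" "\<exists>u. T z n @ t1 = r @ [b] @ u"
      "\<forall>x\<in>cyl (T z n @ t0). tooth (ev M x) a b"
      using Tok[of n z] unfolding ok_def by blast
    have Xz: "X z \<in> cyl (T z n @ t0)" using X[of z "Suc n"] n(2) nxt(1) by (simp add: T(2))
    have Xy: "X y \<in> cyl (T z n @ t1)" using X[of y "Suc n"] n(1) nxt(1) cong[OF yz] by (simp add: T(2))
    obtain u u' where u: "T z n @ t0 = r @ u" "T z n @ t1 = (r @ [b]) @ u'" using nxt(3,4) by auto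
    have "X z \<in> cyl r" using Xz cyl_append[of "X z" r u] u(1) by simp
    then have "ini (X z) a = r" using nxt(2) by (simp add: cyl_def)
    moreover have "X y \<in> cyl (r @ [b])" using Xy cyl_append[of "X y" "r @ [b]" u'] u(2) by simp
    then have "ini (X y) (Suc a) = r @ [b]" using nxt(2) by (simp add: cyl_def)
    then have "ini (X y) a = r" "X y a = b" by (simp_all add: ini_Suc)
    ultimately have "ini (X y) a = ini (X z) a \<and> tooth (ev M (X z)) a (X y a)" using nxt(5) Xz by simp
    then show "\<exists>a. ini (X y) a = ini (X z) a \<and> tooth (ev M (X z)) a (X y a)" ..
  qed
qed

theorem theoremI:
  fixes \<A> \<B> :: "nat set set"
  assumes "\<A> \<subseteq> Pinf" and "\<B> \<subseteq> Pinf"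
    and "hereditary \<A>" and "hereditary \<B>"
    and "orth \<A> \<B>"
    and "analytic \<A>"
    and "C_measurable \<B>" and "is_M_family \<B>"
  shows "countably_generated_in \<A> (perp \<B>) \<or> perfect_Lusin_gap \<A> \<B>"
proof (unfold disj_imp, rule impI)
  assume "\<not> countably_generated_in \<A> (perp \<B>)"
  then obtain v :: "nat list \<Rightarrow> nat \<Rightarrow> nat" where v: "\<And>s p. p + length s \<le> v s p"
    and vB: "\<And>s I. infinite I \<Longrightarrow> v s ` I \<in> \<B>" and vA: "\<And>x. range (\<lambda>k. v (ini x k) (x k)) \<in> \<A>"
    using analytic_tree[OF assms(3,4,6)] by blast
  obtain s M where M: "name s M" and f: "forces s (\<lambda>x. infinite (ev M x) \<and> teeth v x (ev M x) \<in> \<B> \<and>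
    teeth v x (ev M x) \<inter> range (\<lambda>k. v (ini x k) (x k)) = {})"
    using generic_teeth[OF v vB vA assms(7,8,2,5)] by blast
  obtain D :: "nat \<Rightarrow> nat list set" where D: "\<And>i t. \<exists>u. t @ u \<in> D i"
    and gen: "\<And>x. x \<in> cyl s \<Longrightarrow> (\<And>i. \<exists>k. ini x k \<in> D i) \<Longrightarrow> infinite (ev M x) \<and> teeth v x (ev M x) \<in> \<B> \<and>
      teeth v x (ev M x) \<inter> range (\<lambda>k. v (ini x k) (x k)) = {}"
    using f unfolding forces_def by blast
  have inf: "\<forall>x\<in>cyl s. (\<forall>i. \<exists>k. ini x k \<in> D i) \<longrightarrow> infinite (ev M x)" using gen by blast
  obtain X :: "nat set \<Rightarrow> nat \<Rightarrow> nat" where X1: "\<And>z. X z \<in> cyl s" "\<And>z i. \<exists>k. ini (X z) k \<in> D i"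
    and X2: "\<And>y z n. y \<inter> {..<n} = z \<inter> {..<n} \<Longrightarrow>
       ini (X y) n = ini (X z) n \<and> ev M (X y) \<inter> {..<n} = ev M (X z) \<inter> {..<n}"
    and X3: "\<And>y z n. y \<inter> {..<n} = z \<inter> {..<n} \<Longrightarrow> n \<in> y \<Longrightarrow> n \<notin> z \<Longrightarrow>
       \<exists>a. ini (X y) a = ini (X z) a \<and> tooth (ev M (X z)) a (X y a)"
    by (rule perfect_tree[where D = D, OF M D inf]) (rule that)
  define fA where "fA z = range (\<lambda>k. v (ini (X z) k) (X z k))" for z
  define fB where "fB z = teeth v (X z) (ev M (X z))" for z
  have cA: "cantor_continuous fA" unfolding cantor_continuous_def
  proof (intro allI)
    fix z n
    have sub: "fA y \<inter> {..<n} \<subseteq> fA z" if yz: "y \<inter> {..<n} = z \<inter> {..<n}" for y z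
    proof
      fix q assume q: "q \<in> fA y \<inter> {..<n}"
      then obtain k where k: "q = v (ini (X y) k) (X y k)" by (auto simp: fA_def)
      \<comment> \<open>Since \<open>v s p\<close> is at least \<open>p + length s\<close>, a value
        below \<open>n\<close> arises at a level below \<open>n\<close>, where the two branches
        agree.\<close>
      have "k < n" using v[of "X y k" "ini (X y) k"] q k by simp
      then have "ini (X y) (Suc k) = ini (X z) (Suc k)"
        using X2[OF yz] take_ini[of "Suc k" n "X y"] take_ini[of "Suc k" n "X z"] by simp
      then have "q = v (ini (X z) k) (X z k)" using k by (simp add: ini_Suc)
      then show "q \<in> fA z" by (simp add: fA_def)
    qed
    have "fA y \<inter> {..<n} = fA z \<inter> {..<n}" if yz: "y \<inter> {..<n} = z \<inter> {..<n}" for y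
      using sub[OF yz] sub[OF yz[symmetric]] by blast
    then show "\<exists>m. \<forall>y. y \<inter> {..<m} = z \<inter> {..<m} \<longrightarrow> fA y \<inter> {..<n} = fA z \<inter> {..<n}" by blast
  qed
  have cB: "cantor_continuous fB" unfolding cantor_continuous_def
  proof (intro allI exI impI)
    fix z :: "nat set" and n y assume yz: "y \<inter> {..<n} = z \<inter> {..<n}"
    show "fB y \<inter> {..<n} = fB z \<inter> {..<n}" unfolding fB_def
      using X2[OF yz] by (intro teeth_cong[OF v]) simp_all
  qed
  have AB: "fA z \<in> \<A> \<and> fB z \<in> \<B> \<and> fA z \<inter> fB z = {}" for z
    using vA gen[OF X1] unfolding fA_def fB_def by blast
  have gap1: "fA y \<inter> fB z \<noteq> {}" if h: "y \<inter> {..<n} = z \<inter> {..<n}" "n \<in> y" "n \<notin> z" for y z n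
  proof -
    obtain a where a: "ini (X y) a = ini (X z) a" "tooth (ev M (X z)) a (X y a)" using X3[OF h] by blast
    then have "v (ini (X y) a) (X y a) \<in> fB z" unfolding fB_def teeth_def by auto
    then show ?thesis unfolding fA_def by blast
  qed
  have gap: "(fA y \<inter> fB z) \<union> (fA z \<inter> fB y) \<noteq> {}" if "y \<noteq> z" for y z
  proof -
    define n where "n = (LEAST n. (n \<in> y) \<noteq> (n \<in> z))"
    have "\<exists>n. (n \<in> y) \<noteq> (n \<in> z)" using that by blast
    then have n: "(n \<in> y) \<noteq> (n \<in> z)" unfolding n_def by (rule LeastI_ex)
    have "(q \<in> y) = (q \<in> z)" if "q < n" for q using not_less_Least that unfolding n_def by blast
    then have yz: "y \<inter> {..<n} = z \<inter> {..<n}" by auto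
    \<comment> \<open>Whichever set contains the first difference \<open>n\<close> takes the place
      of \<open>y\<close> in \<open>gap1\<close>; the symmetric union covers both cases.\<close>
    show ?thesis using gap1[OF yz] gap1[OF yz[symmetric]] n by blast
  qed
  \<comment> \<open>Equal pairs would make both intersections in \<open>gap\<close> empty, since
    \<open>fA z\<close> and \<open>fB z\<close> are disjoint.\<close>
  have "inj (\<lambda>z. (fA z, fB z))"
  proof (rule injI)
    fix y z assume "(fA y, fB y) = (fA z, fB z)"
    then show "y = z" using gap[of y z] AB by auto
  qed
  then show "perfect_Lusin_gap \<A> \<B>" unfolding perfect_Lusin_gap_def using cA cB AB gap by blast
qed

end
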